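(* The logic $QFDE$ is sound and complete with respect to the class of all $QFDE$-structures: for every signature $\mathcal{S}$ and every $\Gamma\cup\{A\}\subseteq Sent(\mathcal{S})$, $\Gamma\vdash_{QFDE}A$ if and only if, for every $\mathcal{S}$-structure $\mathfrak{A}$, if $v_{\mathfrak{A}}(B)=1$ for every $B\in\Gamma$, then $v_{\mathfrak{A}}(A)=1$.
   Context: **Language of $QFDE$.** A signature is a pair $\mathcal{S}=\langle\mathcal{C},\mathcal{P}\rangle$, where $\mathcal{C}$ is an infinite set of individual constants and $\mathcal{P}$ is a set of predicate letters, each of finite arity, containing a binary identity predicate $\approx$. The logical symbols are $\neg$, $\land,\lor$, $\forall,\exists$, and variables $\mathcal{V}=\{v_i:i\in\mathbb{N}\}$. Terms are variables and constants (no function symbols). Formulas are defined as usual, except that void quantifiers are not allowed: $\forall xB$ and $\exists xB$ are formulas only if $x$ is free in $B$. $Form(\mathcal{S})$ and $Sent(\mathcal{S})$ are the sets of formulas and of sentences (closed formulas). $A(t/x)$ is the result of replacing every free occurrence of $x$ in $A$ by $t$. **Natural deduction system $QFDE$** (over sentences of $\mathcal{S}$; $c,c_1,c_2\in\mathcal{C}$; wherever $A(c/x)$ occurs, $A$ is a formula with no free variable other than $x$; square brackets mark discharged hypotheses): - $\land I$: from $A$, $B$ infer $A\land B$. $\land E$: from $A\land B$ infer $A$; from $A\land B$ infer $B$. - $\lor I$: from $A$ infer $A\lor B$; from $B$ infer $A\lor B$. $\lor E$: from $A\lor B$, a derivation of $C$ from $[A]$ and a derivation of $C$ from $[B]$,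 infer $C$. - $\neg\land I$: from $\neg A$ infer $\neg(A\land B)$; from $\neg B$ infer $\neg(A\land B)$. $\neg\land E$: from $\neg(A\land B)$, a derivation of $C$ from $[\neg A]$ and a derivation of $C$ from $[\neg B]$, infer $C$. - $\neg\lor I$: from $\neg A$, $\neg B$ infer $\neg(A\lor B)$. $\neg\lor E$: from $\neg(A\lor B)$ infer $\neg A$; from $\neg(A\lor B)$ infer $\neg B$. - $DN$: from $A$ infer $\neg\neg A$; from $\neg\neg A$ infer $A$. - $\forall I$: from $B\lor A(c/x)$ infer $B\lor\forall xA$, provided $c$ occurs neither in $A$ or $B$ nor in any hypothesis on which $B\lor A(c/x)$ depends. $\forall E$: from $\forall xA$ infer $A(c/x)$. - $\exists I$: from $A(c/x)$ infer $\exists xA$. $\exists E$: from $\exists xA$ and a derivation of $C$ from $[A(c/x)]$ infer $C$, provided $c$ occurs neither in $A$ or $C$ nor in any hypothesis on which $C$ depends, except $A(c/x)$. - $\neg\forall I$: from $\neg A(c/x)$ infer $\neg\forall xA$. $\neg\forall E$: from $\neg\forall xA$ and a derivation of $C$ from $[\neg A(c/x)]$ infer $C$, provided $c$ occurs neither in $A$ or $C$ nor in any hypothesis on which $C$ depends, except $\neg A(c/x)$. - $\neg\exists I$: from $\neg A(c/x)$ infer $\neg\exists xA$, provided $c$ occurs neither in $A$ nor in any hypothesis on which $\neg A(c/x)$ depends. $\neg\exists E$: from $\neg\exists xA$ infer $\neg A(c/x)$. - $\approx I$: infer $c\approx c$ from no premises. $\approx E$: from $c_1\approx c_2$ and $A(c_1/x)$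 infer $A(c_2/x)$. $\Gamma\vdash_{QFDE}A$ means there is a (finite, tree-shaped) derivation of $A$ all of whose undischarged hypotheses belong to $\Gamma$. **Semantics.** An $\mathcal{S}$-structure ($QFDE$-structure) is a pair $\mathfrak{A}=\langle\mathcal{D},\mathcal{I}\rangle$ with $\mathcal{D}\neq\emptyset$ such that $\mathcal{I}(c)=c^{\mathfrak{A}}\in\mathcal{D}$ for each $c\in\mathcal{C}$; each $n$-ary $P\in\mathcal{P}$ is assigned a pair $\langle P_+^{\mathfrak{A}},P_-^{\mathfrak{A}}\rangle$ with $P_+^{\mathfrak{A}}\cup P_-^{\mathfrak{A}}\subseteq\mathcal{D}^n$; and $\approx_+^{\mathfrak{A}}=\{\langle a,a\rangle:a\in\mathcal{D}\}$ (no constraint on $\approx_-^{\mathfrak A}$). The diagram signature $\mathcal{S}_{\mathfrak{A}}=\langle\mathcal{C}_{\mathfrak{A}},\mathcal{P}\rangle$ adds a new constant $\overline{a}$ for each $a\in\mathcal{D}$; $\widehat{\mathfrak{A}}$ is the $\mathcal{S}_{\mathfrak{A}}$-structure that is just like $\mathfrak{A}$ except that $\overline{a}^{\widehat{\mathfrak{A}}}=a$. The valuation induced by $\mathfrak{A}$ is the (unique) map $v_{\mathfrak{A}}:Sent(\mathcal{S}_{\mathfrak{A}})\to\{0,1\}$ such that, writing $v$ for $v_{\mathfrak A}$: - $v(P(c_1,\dots,c_n))=1$ iff $\langle c_1^{\widehat{\mathfrak{A}}},\dots,c_n^{\widehat{\mathfrak{A}}}\rangle\in P_+^{\mathfrak{A}}$,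 and $v(\neg P(c_1,\dots,c_n))=1$ iff $\langle c_1^{\widehat{\mathfrak{A}}},\dots,c_n^{\widehat{\mathfrak{A}}}\rangle\in P_-^{\mathfrak{A}}$, for all $c_1,\dots,c_n\in\mathcal{C}_{\mathfrak{A}}$; - $v(A\land B)=1$ iff $v(A)=1$ and $v(B)=1$; $v(A\lor B)=1$ iff $v(A)=1$ or $v(B)=1$; - $v(\neg(A\land B))=1$ iff $v(\neg A)=1$ or $v(\neg B)=1$; $v(\neg(A\lor B))=1$ iff $v(\neg A)=1$ and $v(\neg B)=1$; - $v(\neg\neg A)=1$ iff $v(A)=1$; - $v(\forall xA)=1$ iff $v(A(\overline{a}/x))=1$ for every $a\in\mathcal{D}$; $v(\exists xA)=1$ iff $v(A(\overline{a}/x))=1$ for some $a\in\mathcal{D}$; - $v(\neg\forall xA)=1$ iff $v(\neg A(\overline{a}/x))=1$ for some $a\in\mathcal{D}$; $v(\neg\exists xA)=1$ iff $v(\neg A(\overline{a}/x))=1$ for every $a\in\mathcal{D}$. *)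

theory Defs
  imports Main
begin

section \<open>Language\<close>

text \<open>The field \<open>ident\<close> is the binary identity predicate \<open>\<approx>\<close>, one of the
  predicate letters.\<close>

record ('c, 'p) signature =
  csts :: "'c set"
  preds :: "'p set"
  arity :: "'p \<Rightarrow> nat"
  ident :: "'p"

definition is_signature :: "('c, 'p) signature \<Rightarrow> bool" where
  "is_signature S \<longleftrightarrow> infinite (csts S) \<and> ident S \<in> preds S \<and> arity S (ident S) = 2"

datatype (csts_tm: 'c) tm = Var nat | Cst 'c

datatype (csts_fm: 'c, preds_fm: 'p) fm =
    Pred 'p "'c tm list"
  | Neg "('c, 'p) fm"
  | Con "('c, 'p) fm" "('c, 'p) fm"
  | Dis "('c, 'p) fm" "('c, 'p) fm"
  | All nat "('c, 'p) fm"
  | Ex nat "('c, 'p) fm"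

primrec fv :: "('c, 'p) fm \<Rightarrow> nat set" where
  "fv (Pred p ts) = {x. Var x \<in> set ts}"
| "fv (Neg A) = fv A"
| "fv (Con A B) = fv A \<union> fv B"
| "fv (Dis A B) = fv A \<union> fv B"
| "fv (All x A) = fv A - {x}"
| "fv (Ex x A) = fv A - {x}"

text \<open>\<open>subst A x t\<close> replaces the free occurrences of \<open>x\<close> in \<open>A\<close> by \<open>t\<close>.  It does not
  rename bound variables; below, \<open>t\<close> is always a constant, so nothing can be captured.\<close>

primrec subst :: "('c, 'p) fm \<Rightarrow> nat \<Rightarrow> 'c tm \<Rightarrow> ('c, 'p) fm" where
  "subst (Pred p ts) x t = Pred p (map (\<lambda>s. if s = Var x then t else s) ts)"
| "subst (Neg A) x t = Neg (subst A x t)"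
| "subst (Con A B) x t = Con (subst A x t) (subst B x t)"
| "subst (Dis A B) x t = Dis (subst A x t) (subst B x t)"
| "subst (All y A) x t = All y (if y = x then A else subst A x t)"
| "subst (Ex y A) x t = Ex y (if y = x then A else subst A x t)"

text \<open>The conditions \<open>x \<in> fv A\<close> exclude void quantifiers.\<close>

primrec is_form :: "('c, 'p) signature \<Rightarrow> ('c, 'p) fm \<Rightarrow> bool" where
  "is_form S (Pred p ts) \<longleftrightarrow>
     p \<in> preds S \<and> length ts = arity S p \<and> (\<forall>t\<in>set ts. csts_tm t \<subseteq> csts S)"
| "is_form S (Neg A) \<longleftrightarrow> is_form S A"
| "is_form S (Con A B) \<longleftrightarrow> is_form S A \<and> is_form S B"
| "is_form S (Dis A B) \<longleftrightarrow> is_form S A \<and> is_form S B"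
| "is_form S (All x A) \<longleftrightarrow> is_form S A \<and> x \<in> fv A"
| "is_form S (Ex x A) \<longleftrightarrow> is_form S A \<and> x \<in> fv A"

definition Form :: "('c, 'p) signature \<Rightarrow> ('c, 'p) fm set" where
  "Form S = {A. is_form S A}"

definition Sent :: "('c, 'p) signature \<Rightarrow> ('c, 'p) fm set" where
  "Sent S = {A \<in> Form S. fv A = {}}"

definition Eql :: "('c, 'p) signature \<Rightarrow> 'c \<Rightarrow> 'c \<Rightarrow> ('c, 'p) fm" where
  "Eql S c d = Pred (ident S) [Cst c, Cst d]"


section \<open>Natural deduction\<close>

text \<open>\<open>deriv S H A\<close>: there is a derivation tree of \<open>A\<close> whose set of undischarged hypotheses
  is exactly \<open>H\<close>.  There is no weakening: \<open>H\<close> consists of the hypotheses on which \<open>A\<close> actually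
  depends, which is what the provisos on \<open>c\<close> refer to.  A discharge removes all occurrences
  of the hypothesis and may be vacuous.  The \<open>Sent\<close> and \<open>Form\<close> premises keep every formula
  of the tree a sentence of \<open>S\<close>; in the quantifier rules they imply \<open>fv A = {x}\<close>.\<close>

inductive deriv :: "('c, 'p) signature \<Rightarrow> ('c, 'p) fm set \<Rightarrow> ('c, 'p) fm \<Rightarrow> bool"
  for S :: "('c, 'p) signature" where
  Hyp: "A \<in> Sent S \<Longrightarrow> deriv S {A} A"
| ConI: "deriv S H1 A \<Longrightarrow> deriv S H2 B \<Longrightarrow> deriv S (H1 \<union> H2) (Con A B)"
| ConE1: "deriv S H (Con A B) \<Longrightarrow> deriv S H A"
| ConE2: "deriv S H (Con A B) \<Longrightarrow> deriv S H B"
| DisI1: "deriv S H A \<Longrightarrow> B \<in> Sent S \<Longrightarrow> deriv S H (Dis A B)"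
| DisI2: "deriv S H B \<Longrightarrow> A \<in> Sent S \<Longrightarrow> deriv S H (Dis A B)"
| DisE: "deriv S H (Dis A B) \<Longrightarrow> deriv S H1 C \<Longrightarrow> deriv S H2 C \<Longrightarrow>
    deriv S (H \<union> (H1 - {A}) \<union> (H2 - {B})) C"
| NegConI1: "deriv S H (Neg A) \<Longrightarrow> B \<in> Sent S \<Longrightarrow> deriv S H (Neg (Con A B))"
| NegConI2: "deriv S H (Neg B) \<Longrightarrow> A \<in> Sent S \<Longrightarrow> deriv S H (Neg (Con A B))"
| NegConE: "deriv S H (Neg (Con A B)) \<Longrightarrow> deriv S H1 C \<Longrightarrow> deriv S H2 C \<Longrightarrow>
    deriv S (H \<union> (H1 - {Neg A}) \<union> (H2 - {Neg B})) C"
| NegDisI: "deriv S H1 (Neg A) \<Longrightarrow> deriv S H2 (Neg B) \<Longrightarrow>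
    deriv S (H1 \<union> H2) (Neg (Dis A B))"
| NegDisE1: "deriv S H (Neg (Dis A B)) \<Longrightarrow> deriv S H (Neg A)"
| NegDisE2: "deriv S H (Neg (Dis A B)) \<Longrightarrow> deriv S H (Neg B)"
| DNI: "deriv S H A \<Longrightarrow> deriv S H (Neg (Neg A))"
| DNE: "deriv S H (Neg (Neg A)) \<Longrightarrow> deriv S H A"
| AllI: "deriv S H (Dis B (subst A x (Cst c))) \<Longrightarrow> c \<in> csts S \<Longrightarrow> All x A \<in> Sent S \<Longrightarrow>
    c \<notin> csts_fm A \<Longrightarrow> c \<notin> csts_fm B \<Longrightarrow> (\<forall>D\<in>H. c \<notin> csts_fm D) \<Longrightarrow>
    deriv S H (Dis B (All x A))"
| AllE: "deriv S H (All x A) \<Longrightarrow> c \<in> csts S \<Longrightarrow> deriv S H (subst A x (Cst c))"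
| ExI: "deriv S H (subst A x (Cst c)) \<Longrightarrow> c \<in> csts S \<Longrightarrow> Ex x A \<in> Sent S \<Longrightarrow>
    deriv S H (Ex x A)"
| ExE: "deriv S H (Ex x A) \<Longrightarrow> deriv S H1 C \<Longrightarrow> c \<in> csts S \<Longrightarrow>
    c \<notin> csts_fm A \<Longrightarrow> c \<notin> csts_fm C \<Longrightarrow>
    (\<forall>D\<in>H1 - {subst A x (Cst c)}. c \<notin> csts_fm D) \<Longrightarrow>
    deriv S (H \<union> (H1 - {subst A x (Cst c)})) C"
| NegAllI: "deriv S H (Neg (subst A x (Cst c))) \<Longrightarrow> c \<in> csts S \<Longrightarrow> All x A \<in> Sent S \<Longrightarrow>
    deriv S H (Neg (All x A))"
| NegAllE: "deriv S H (Neg (All x A)) \<Longrightarrow> deriv S H1 C \<Longrightarrow> c \<in> csts S \<Longrightarrow>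
    c \<notin> csts_fm A \<Longrightarrow> c \<notin> csts_fm C \<Longrightarrow>
    (\<forall>D\<in>H1 - {Neg (subst A x (Cst c))}. c \<notin> csts_fm D) \<Longrightarrow>
    deriv S (H \<union> (H1 - {Neg (subst A x (Cst c))})) C"
| NegExI: "deriv S H (Neg (subst A x (Cst c))) \<Longrightarrow> c \<in> csts S \<Longrightarrow> Ex x A \<in> Sent S \<Longrightarrow>
    c \<notin> csts_fm A \<Longrightarrow> (\<forall>D\<in>H. c \<notin> csts_fm D) \<Longrightarrow>
    deriv S H (Neg (Ex x A))"
| NegExE: "deriv S H (Neg (Ex x A)) \<Longrightarrow> c \<in> csts S \<Longrightarrow> deriv S H (Neg (subst A x (Cst c)))"
| IdI: "c \<in> csts S \<Longrightarrow> deriv S {} (Eql S c c)"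
| IdE: "deriv S H1 (Eql S c1 c2) \<Longrightarrow> deriv S H2 (subst A x (Cst c1)) \<Longrightarrow>
    A \<in> Form S \<Longrightarrow> fv A \<subseteq> {x} \<Longrightarrow> deriv S (H1 \<union> H2) (subst A x (Cst c2))"

definition provable :: "('c, 'p) signature \<Rightarrow> ('c, 'p) fm set \<Rightarrow> ('c, 'p) fm \<Rightarrow> bool" where
  "provable S \<Gamma> A \<longleftrightarrow> (\<exists>H\<subseteq>\<Gamma>. deriv S H A)"


section \<open>Semantics\<close>

record ('c, 'p, 'd) struct =
  dom :: "'d set"
  cint :: "'c \<Rightarrow> 'd"
  pos :: "'p \<Rightarrow> 'd list set"
  neg :: "'p \<Rightarrow> 'd list set"

definition is_struct :: "('c, 'p) signature \<Rightarrow> ('c, 'p, 'd) struct \<Rightarrow> bool" where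
  "is_struct S M \<longleftrightarrow>
     dom M \<noteq> {} \<and>
     (\<forall>c\<in>csts S. cint M c \<in> dom M) \<and>
     (\<forall>p\<in>preds S. pos M p \<union> neg M p \<subseteq> {as. length as = arity S p \<and> set as \<subseteq> dom M}) \<and>
     pos M (ident S) = {[a, a] |a. a \<in> dom M}"

text \<open>The constants of the diagram signature are the \<open>Inl c\<close> with \<open>c\<close> a constant of the
  signature, and the new constants \<open>Inr a\<close> naming the elements \<open>a\<close> of the domain.\<close>

definition diag_sig ::
    "('c, 'p) signature \<Rightarrow> ('c, 'p, 'd) struct \<Rightarrow> ('c + 'd, 'p) signature" where
  "diag_sig S M = \<lparr>csts = Inl ` csts S \<union> Inr ` dom M,
     preds = preds S, arity = arity S, ident = ident S\<rparr>"

definition hat :: "('c, 'p, 'd) struct \<Rightarrow> ('c + 'd, 'p, 'd) struct" where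
  "hat M = \<lparr>dom = dom M, cint = case_sum (cint M) (\<lambda>a. a), pos = pos M, neg = neg M\<rparr>"

abbreviation embed :: "('c, 'p) fm \<Rightarrow> ('c + 'd, 'p) fm" where
  "embed \<equiv> map_fm Inl (\<lambda>p. p)"

fun the_cst :: "'c tm \<Rightarrow> 'c" where
  "the_cst (Cst c) = c"
| "the_cst (Var x) = undefined"

primrec complexity :: "('c, 'p) fm \<Rightarrow> nat" where
  "complexity (Pred p ts) = 0"
| "complexity (Neg A) = Suc (complexity A)"
| "complexity (Con A B) = Suc (complexity A + complexity B)"
| "complexity (Dis A B) = Suc (complexity A + complexity B)"
| "complexity (All x A) = Suc (complexity A)"
| "complexity (Ex x A) = Suc (complexity A)"

lemma complexity_subst [simp]: "complexity (subst A x t) = complexity A"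
  by (induction A) auto

text \<open>The valuation induced by \<open>M\<close>, with \<open>True\<close> for the value 1 and \<open>False\<close> for 0.  It is
  meaningful on \<open>Sent (diag_sig S M)\<close> only; on other formulas its value is irrelevant.\<close>

function val :: "('c, 'p, 'd) struct \<Rightarrow> ('c + 'd, 'p) fm \<Rightarrow> bool" where
  "val M (Pred p ts) \<longleftrightarrow> map (\<lambda>t. cint (hat M) (the_cst t)) ts \<in> pos M p"
| "val M (Neg (Pred p ts)) \<longleftrightarrow> map (\<lambda>t. cint (hat M) (the_cst t)) ts \<in> neg M p"
| "val M (Con A B) \<longleftrightarrow> val M A \<and> val M B"
| "val M (Dis A B) \<longleftrightarrow> val M A \<or> val M B"
| "val M (Neg (Con A B)) \<longleftrightarrow> val M (Neg A) \<or> val M (Neg B)"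
| "val M (Neg (Dis A B)) \<longleftrightarrow> val M (Neg A) \<and> val M (Neg B)"
| "val M (Neg (Neg A)) \<longleftrightarrow> val M A"
| "val M (All x A) \<longleftrightarrow> (\<forall>a\<in>dom M. val M (subst A x (Cst (Inr a))))"
| "val M (Ex x A) \<longleftrightarrow> (\<exists>a\<in>dom M. val M (subst A x (Cst (Inr a))))"
| "val M (Neg (All x A)) \<longleftrightarrow> (\<exists>a\<in>dom M. val M (Neg (subst A x (Cst (Inr a)))))"
| "val M (Neg (Ex x A)) \<longleftrightarrow> (\<forall>a\<in>dom M. val M (Neg (subst A x (Cst (Inr a)))))"
  by pat_completeness auto
termination
  by (relation "measure (\<lambda>(M, A). complexity A)") auto

definition entails ::
    "'d itself \<Rightarrow> ('c, 'p) signature \<Rightarrow> ('c, 'p) fm set \<Rightarrow> ('c, 'p) fm \<Rightarrow> bool" where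
  "entails (_ :: 'd itself) S \<Gamma> A \<longleftrightarrow>
     (\<forall>M :: ('c, 'p, 'd) struct. is_struct S M \<longrightarrow>
        (\<forall>B\<in>\<Gamma>. val M (embed B)) \<longrightarrow> val M (embed A))"

text \<open>HOL cannot quantify over all types \<open>'d\<close> inside a formula, so consequence with
  respect to all structures is expressed by \<open>entails TYPE('d)\<close> for a type variable \<open>'d\<close>.  If
  \<open>'d\<close> is small (say finite), consequence over the structures with domain in \<open>'d\<close> is a larger
  relation than consequence over all structures; the following condition excludes this, since
  by Loewenheim-Skolem every countermodel can be replaced by one with at most
  as many elements as there are formulas.\<close>

definition large_type :: "'d itself \<Rightarrow> ('c, 'p) signature \<Rightarrow> bool" where
  "large_type (_ :: 'd itself) S \<longleftrightarrow> (\<exists>f :: ('c, 'p) fm \<Rightarrow> 'd. inj_on f (Form S))"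

end

theory Submission
  imports Defs
begin

text \<open>Completeness is a Henkin argument, with three deviations forced by the setting.
  Quantified sentences occur positively and negated on both sides, and there is no implication;
  so one extends a pair of premises and excluded conclusions, with witnesses for the excluded
  \<open>\<forall>xA\<close> and \<open>\<not>\<exists>xA\<close> as well as for the accepted \<open>\<exists>xA\<close> and \<open>\<not>\<forall>xA\<close>.  The side disjunct in
  \<open>\<forall>I\<close> is what makes the former conservative; \<open>\<not>\<exists>I\<close> has no such disjunct, but
  \<open>\<forall>x\<not>A\<close> entails \<open>\<not>\<exists>xA\<close>.  Signatures may be uncountable, so all witnesses are adjoined at once
  and Zorn's lemma is applied to consequence modulo finitely many witness conditions.\<close>

section \<open>Syntax\<close>

abbreviation ren :: "('a \<Rightarrow> 'b) \<Rightarrow> ('a, 'p) fm \<Rightarrow> ('b, 'p) fm" where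
  "ren f \<equiv> map_fm f (\<lambda>p. p)"

lemma map_tm_eq_Var [simp]: "map_tm f t = Var x \<longleftrightarrow> t = Var x" "Var x = map_tm f t \<longleftrightarrow> t = Var x"
  by (cases t; auto)+

lemma fv_map_fm [simp]: "fv (map_fm f g A) = fv A"
  by (induction A) (auto simp: image_iff)

lemma fv_subst_Cst [simp]: "fv (subst A x (Cst c)) = fv A - {x}"
  by (induction A) (auto simp: image_iff split: if_splits)

lemma ren_subst [simp]: "ren f (subst A x (Cst c)) = subst (ren f A) x (Cst (f c))"
  by (induction A) auto

lemma ren_Eql [simp]: "ren f (Eql S c d) = Pred (ident S) [Cst (f c), Cst (f d)]"
  by (simp add: Eql_def)

lemma csts_subst_subset: "csts_fm (subst A x (Cst c)) \<subseteq> insert c (csts_fm A)"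
proof (induction A)
  case (Pred p ts)
  show ?case by (auto split: if_splits)
qed auto

lemma csts_subset_subst: "csts_fm A \<subseteq> csts_fm (subst A x (Cst c))"
proof (induction A)
  case (Pred p ts)
  have "csts_tm t \<subseteq> csts_tm (if t = Var x then Cst c else t)" for t by simp
  then show ?case unfolding subst.simps fm.set set_map by blast
qed auto

lemma finite_csts_fm: "finite (csts_fm A)"
proof (induction A)
  case (Pred p ts)
  have "finite (csts_tm t)" for t :: "'a tm" by (cases t) auto
  then show ?case by auto
qed auto

lemma is_form_subst: "is_form S A \<Longrightarrow> c \<in> csts S \<Longrightarrow> is_form S (subst A x (Cst c))"
  by (induction A) auto

lemma csts_is_form: "is_form S A \<Longrightarrow> csts_fm A \<subseteq> csts S"
  by (induction A) auto

lemma preds_is_form: "is_form S A \<Longrightarrow> preds_fm A \<subseteq> preds S"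
  by (induction A) auto

lemma is_form_ren:
  assumes "preds S2 = preds S1" "arity S2 = arity S1"
  shows "is_form S1 A \<Longrightarrow> f ` csts_fm A \<subseteq> csts S2 \<Longrightarrow> is_form S2 (ren f A)"
proof (induction A)
  case (Pred p ts)
  have "csts_tm (map_tm f t) \<subseteq> csts S2" if "t \<in> set ts" for t
  proof (cases t)
    case (Cst c)
    then have "c \<in> csts_fm (Pred p ts)" using that by (auto intro!: bexI[of _ t])
    then show ?thesis using Pred(2) Cst by auto
  qed simp
  then show ?case using Pred assms by auto
qed auto

lemma Sent_simps [simp]:
  "Neg A \<in> Sent S \<longleftrightarrow> A \<in> Sent S"
  "Con A B \<in> Sent S \<longleftrightarrow> A \<in> Sent S \<and> B \<in> Sent S"
  "Dis A B \<in> Sent S \<longleftrightarrow> A \<in> Sent S \<and> B \<in> Sent S"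
  by (auto simp: Sent_def Form_def)

lemma subst_Sent:
  "All x A \<in> Sent S \<Longrightarrow> c \<in> csts S \<Longrightarrow> subst A x (Cst c) \<in> Sent S"
  "Ex x A \<in> Sent S \<Longrightarrow> c \<in> csts S \<Longrightarrow> subst A x (Cst c) \<in> Sent S"
  by (auto simp: Sent_def Form_def is_form_subst)

lemma Eql_Sent:
  "is_signature S \<Longrightarrow> Eql S c d \<in> Sent S \<longleftrightarrow> c \<in> csts S \<and> d \<in> csts S"
  by (auto simp: Sent_def Form_def Eql_def is_signature_def)

lemma csts_Sent: "A \<in> Sent S \<Longrightarrow> csts_fm A \<subseteq> csts S"
  by (simp add: Sent_def Form_def csts_is_form)

lemma ren_Sent:
  assumes "preds S2 = preds S1" "arity S2 = arity S1"
  shows "A \<in> Sent S1 \<Longrightarrow> csts_fm A \<subseteq> K \<Longrightarrow> f ` K \<subseteq> csts S2 \<Longrightarrow> ren f A \<in> Sent S2"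
  using is_form_ren[OF assms, of A f] by (auto simp: Sent_def Form_def)

lemma inj_on_ren: "inj_on f K \<Longrightarrow> inj_on (ren f) {A. csts_fm A \<subseteq> K}"
  by (rule inj_onI, erule fm.inj_map_strong[rotated 2]) (blast dest: inj_onD)+

section \<open>Derivations\<close>

lemma deriv_Sent:
  assumes "is_signature S"
  shows "deriv S H A \<Longrightarrow> H \<subseteq> Sent S \<and> A \<in> Sent S"
proof (induction rule: deriv.induct)
  case (IdE H1 c1 c2 H2 A x)
  \<comment> \<open>Rule \<open>IdE\<close> does not itself ask for \<open>c2\<close> to be in the
    signature; it follows because \<open>Eql S c1 c2\<close> is a sentence.\<close>
  then have "c2 \<in> csts S" using assms by (simp add: Eql_Sent)
  then show ?case using IdE by (auto simp: Sent_def Form_def is_form_subst)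
qed (use assms in \<open>auto simp: Eql_Sent intro: subst_Sent, (auto simp: Sent_def Form_def)?\<close>)

lemma deriv_finite: "deriv S H A \<Longrightarrow> finite H"
  by (induction rule: deriv.induct) auto

section \<open>Soundness\<close>

text \<open>Names of domain elements stay fixed, so renaming commutes with the instances by which
  \<open>val\<close> evaluates quantifiers.\<close>

lemma val_ren_cong:
  assumes "\<And>c. cint (hat M) (f c) = cint (hat M) c" "\<And>a. f (Inr a) = Inr a"
  shows "val M (ren f A) \<longleftrightarrow> val M A"
proof -
  have "cint (hat M) (the_cst (map_tm f t)) = cint (hat M) (the_cst t)" for t
    using assms(1) by (cases t) auto
  then show ?thesis
    by (induction M A rule: val.induct) (auto simp: o_def assms(2))
qed

text \<open>Each constant gives way to the name of its value, so the assignment \<open>e\<close> can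
  be changed at one constant while \<open>M\<close> stays the same.\<close>

abbreviation val_in :: "('c, 'p, 'd) struct \<Rightarrow> ('c0 \<Rightarrow> 'd) \<Rightarrow> ('c0, 'p) fm \<Rightarrow> bool" where
  "val_in M e A \<equiv> val M (ren (\<lambda>c. Inr (e c)) A)"

lemma val_embed: "val M (embed A) \<longleftrightarrow> val_in M (cint M) A"
proof -
  let ?f = "\<lambda>c. Inr (cint (hat M) c)"
  have "val M (ren ?f (embed A)) \<longleftrightarrow> val M (embed A)"
    by (rule val_ren_cong) (auto simp: hat_def)
  then show ?thesis by (simp add: fm.map_comp o_def hat_def)
qed

lemma ren_fresh [simp]:
  "c \<notin> csts_fm A \<Longrightarrow> ren (\<lambda>d. Inr (if d = c then a else e d)) A = ren (\<lambda>d. Inr (e d)) A"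
  by (rule fm.map_cong) auto

text \<open>The eigenconstant rules are why \<open>e\<close> varies in the induction: the
  subderivation is evaluated with \<open>c\<close> sent to an element \<open>a\<close>, which does
  not affect formulas without \<open>c\<close>.\<close>

lemma soundness_assignment:
  assumes S: "is_signature S" and M: "is_struct S M"
  shows "deriv S H A \<Longrightarrow> (\<forall>c\<in>csts S. e c \<in> dom M) \<Longrightarrow> (\<forall>B\<in>H. val_in M e B) \<Longrightarrow> val_in M e A"
proof (induction arbitrary: e rule: deriv.induct)
  case (AllI H B A x c)
  show ?case
  \<comment> \<open>If \<open>B\<close> fails under \<open>e\<close>, it fails however
    \<open>c\<close> is reinterpreted, so the instance of \<open>A\<close> must hold at every
    \<open>a\<close>.\<close>
  proof (cases "val_in M e B")
    case False
    have "val M (subst (ren (\<lambda>c. Inr (e c)) A) x (Cst (Inr a)))" if a: "a \<in> dom M" for a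
    proof -
      have "val_in M (e(c := a)) (Dis B (subst A x (Cst c)))"
        by (rule AllI.IH) (use AllI a in auto)
        then show ?thesis using False AllI by simp
    qed
    then show ?thesis by simp
  qed simp
next
  case (ExE H x A H1 C c)
  from ExE(6) ExE.prems ExE.IH(1)[of e] obtain a
    where a: "a \<in> dom M" "val M (subst (ren (\<lambda>c. Inr (e c)) A) x (Cst (Inr a)))" by auto
  have "val_in M (e(c := a)) D" if "D \<in> H1" for D
  proof (cases "D = subst A x (Cst c)")
    case True
    then show ?thesis using a ExE by simp
  next
    case False
    then show ?thesis using ExE that by auto
  qed
  then have "val_in M (e(c := a)) C" using ExE a by (intro ExE.IH(2)) auto
  then show ?case using ExE by simp
next
  case (NegAllE H x A H1 C c)
  from NegAllE.prems NegAllE.IH(1)[of e] obtain a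
    where a: "a \<in> dom M" "val M (Neg (subst (ren (\<lambda>c. Inr (e c)) A) x (Cst (Inr a))))" by auto
  have "val_in M (e(c := a)) D" if "D \<in> H1" for D
  proof (cases "D = Neg (subst A x (Cst c))")
    case True
    then show ?thesis using a NegAllE by simp
  next
    case False
    then show ?thesis using NegAllE that by auto
  qed
  then have "val_in M (e(c := a)) C" using NegAllE a by (intro NegAllE.IH(2)) auto
  then show ?case using NegAllE by simp
next
  case (NegExI H A x c)
  have "val M (Neg (subst (ren (\<lambda>c. Inr (e c)) A) x (Cst (Inr a))))" if a: "a \<in> dom M" for a
  proof -
    have "val_in M (e(c := a)) (Neg (subst A x (Cst c)))"
      by (rule NegExI.IH) (use NegExI a in auto)
    then show ?thesis using NegExI by simp
  qed
  then show ?case by simp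
next
  case (DisE H A B H1 C H2)
  from DisE.IH(1)[of e] DisE.prems consider "val_in M e A" | "val_in M e B" by auto
  then show ?case
    by cases (use DisE in \<open>blast+\<close>)
next
  case (NegConE H A B H1 C H2)
  from NegConE.IH(1)[of e] NegConE.prems
  consider "val_in M e (Neg A)" | "val_in M e (Neg B)" by auto
  then show ?case
    by cases (use NegConE in \<open>blast+\<close>)
next
  case (IdI c)
  then show ?case using M by (auto simp: is_struct_def hat_def)
next
  case (IdE H1 c1 c2 H2 A x)
  have "val_in M e (Eql S c1 c2)" using IdE by blast
  then have "e c1 = e c2" using M by (auto simp: is_struct_def hat_def)
  then show ?case using IdE.IH(2)[of e] IdE.prems by auto
qed auto

lemma soundness:
  fixes M :: "('c, 'p, 'd) struct"
  assumes "is_signature S" "is_struct S M" "provable S \<Gamma> A" "\<forall>B\<in>\<Gamma>. val M (embed B)"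
  shows "val M (embed A)"
proof -
  obtain H where H: "H \<subseteq> \<Gamma>" "deriv S H A" using assms by (auto simp: provable_def)
  have "val_in M (cint M) A"
    by (rule soundness_assignment[OF assms(1,2) H(2)])
      (use H assms in \<open>auto simp: is_struct_def val_embed[symmetric]\<close>)
  then show ?thesis by (simp add: val_embed)
qed

section \<open>Renaming the constants of a derivation\<close>

text \<open>Discharge removes one formula from a set, so a renaming must not identify it with
  another hypothesis.\<close>

lemma ren_mem_Diff:
  assumes "inj_on f K" "\<forall>D\<in>H. csts_fm D \<subseteq> K" "csts_fm A \<subseteq> K"
  shows "ren f ` (H - {A}) = ren f ` H - {ren f A}"
  using inj_on_image_set_diff[OF inj_on_ren[OF assms(1)], of H "{A}"] assms by auto

lemma fresh_ren:
  assumes "inj_on f K" "c \<in> K" "csts_fm A \<subseteq> K"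
  shows "f c \<in> csts_fm (ren f A) \<longleftrightarrow> c \<in> csts_fm A"
  using inj_on_image_mem_iff[OF assms] by (simp add: fm.set_map)

lemma eventually_ren_Sent:
  assumes "preds S2 = preds S1" "arity S2 = arity S1" "A \<in> Sent S1"
  shows "\<forall>\<^sub>F K in finite_subsets_at_top (csts S1).
    csts_fm A \<subseteq> K \<and> (\<forall>f. f ` K \<subseteq> csts S2 \<longrightarrow> ren f A \<in> Sent S2)"
  unfolding eventually_finite_subsets_at_top
  by (intro exI[of _ "csts_fm A"] conjI allI impI finite_csts_fm csts_Sent[OF assms(3)]
      ren_Sent[OF assms]) auto

lemma eventually_cst_mem:
  assumes "c \<in> csts S"
  shows "\<forall>\<^sub>F K in finite_subsets_at_top (csts S). c \<in> K"
  unfolding eventually_finite_subsets_at_top using assms by (intro exI[of _ "{c}"]) auto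

text \<open>A derivation mentions finitely many constants, and renaming preserves it as soon as it
  is injective on those; the filter spares the bookkeeping of a finite set that grows with
  each rule.\<close>

lemma deriv_ren:
  assumes S1: "is_signature S1"
    and S2: "preds S2 = preds S1" "arity S2 = arity S1" "ident S2 = ident S1"
  shows "deriv S1 H A \<Longrightarrow> \<forall>\<^sub>F K in finite_subsets_at_top (csts S1).
    (\<forall>D\<in>H. csts_fm D \<subseteq> K) \<and> csts_fm A \<subseteq> K \<and>
    (\<forall>f. inj_on f K \<longrightarrow> f ` K \<subseteq> csts S2 \<longrightarrow> deriv S2 (ren f ` H) (ren f A))"
proof (induction rule: deriv.induct)
  case (Hyp A)
  show ?case using eventually_ren_Sent[OF S2(1,2) Hyp]
    by eventually_elim (auto intro: deriv.Hyp)
next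
  case (ConI H1 A H2 B)
  show ?case using ConI.IH
    by eventually_elim (auto simp: image_Un intro!: deriv.ConI)
next
  case (ConE1 H A B)
  show ?case using ConE1.IH
    by eventually_elim (auto intro: deriv.ConE1)
next
  case (ConE2 H A B)
  show ?case using ConE2.IH
    by eventually_elim (auto intro: deriv.ConE2)
next
  case (DisI1 H A B)
  show ?case using DisI1.IH eventually_ren_Sent[OF S2(1,2) DisI1.hyps(2)]
    by eventually_elim (auto intro: deriv.DisI1)
next
  case (DisI2 H B A)
  show ?case using DisI2.IH eventually_ren_Sent[OF S2(1,2) DisI2.hyps(2)]
    by eventually_elim (auto intro: deriv.DisI2)
next
  case (DisE H A B H1 C H2)
  show ?case using DisE.IH
  proof eventually_elim
    case (elim K)
    have "deriv S2 (ren f ` (H \<union> (H1 - {A}) \<union> (H2 - {B}))) (ren f C)"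
      if f: "inj_on f K" "f ` K \<subseteq> csts S2" for f
    proof -
      have "ren f ` (H1 - {A}) = ren f ` H1 - {ren f A}" "ren f ` (H2 - {B}) = ren f ` H2 - {ren f B}"
        by (rule ren_mem_Diff[OF f(1)]; use elim in simp)+
      moreover have "deriv S2 (ren f ` H) (Dis (ren f A) (ren f B))"
        "deriv S2 (ren f ` H1) (ren f C)" "deriv S2 (ren f ` H2) (ren f C)"
        using elim f by auto
      ultimately show ?thesis unfolding image_Un by (simp add: deriv.DisE)
    qed
    then show ?case using elim by auto
  qed
next
  case (NegConI1 H A B)
  show ?case using NegConI1.IH eventually_ren_Sent[OF S2(1,2) NegConI1.hyps(2)]
    by eventually_elim (auto intro: deriv.NegConI1)
next
  case (NegConI2 H B A)
  show ?case using NegConI2.IH eventually_ren_Sent[OF S2(1,2) NegConI2.hyps(2)]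
    by eventually_elim (auto intro: deriv.NegConI2)
next
  case (NegConE H A B H1 C H2)
  show ?case using NegConE.IH
  proof eventually_elim
    case (elim K)
    have "deriv S2 (ren f ` (H \<union> (H1 - {Neg A}) \<union> (H2 - {Neg B}))) (ren f C)"
      if f: "inj_on f K" "f ` K \<subseteq> csts S2" for f
    proof -
      have "ren f ` (H1 - {Neg A}) = ren f ` H1 - {ren f (Neg A)}"
        "ren f ` (H2 - {Neg B}) = ren f ` H2 - {ren f (Neg B)}"
        by (rule ren_mem_Diff[OF f(1)]; use elim in simp)+
      moreover have "deriv S2 (ren f ` H) (Neg (Con (ren f A) (ren f B)))"
        "deriv S2 (ren f ` H1) (ren f C)" "deriv S2 (ren f ` H2) (ren f C)"
        using elim f by auto
      ultimately show ?thesis unfolding image_Un by (simp add: deriv.NegConE)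
    qed
    then show ?case using elim by auto
  qed
next
  case (NegDisI H1 A H2 B)
  show ?case using NegDisI.IH
    by eventually_elim (auto simp: image_Un intro!: deriv.NegDisI)
next
  case (NegDisE1 H A B)
  show ?case using NegDisE1.IH
    by eventually_elim (auto intro: deriv.NegDisE1)
next
  case (NegDisE2 H A B)
  show ?case using NegDisE2.IH
    by eventually_elim (auto intro: deriv.NegDisE2)
next
  case (DNI H A)
  show ?case using DNI.IH
    by eventually_elim (auto intro: deriv.DNI)
next
  case (DNE H A)
  show ?case using DNE.IH
    by eventually_elim (auto intro: deriv.DNE)
next
  case (AllI H B A x c)
  show ?case using AllI.IH eventually_cst_mem[OF \<open>c \<in> csts S1\<close>]
  proof eventually_elim
    case (elim K)
    have A: "csts_fm A \<subseteq> K" using elim csts_subset_subst[of A x c] by auto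
    have "deriv S2 (ren f ` H) (ren f (Dis B (All x A)))"
      if f: "inj_on f K" "f ` K \<subseteq> csts S2" for f
    proof -
      have d: "deriv S2 (ren f ` H) (Dis (ren f B) (subst (ren f A) x (Cst (f c))))"
        using elim f by auto
      have Sent: "All x (ren f A) \<in> Sent S2"
        by (rule ren_Sent[OF S2(1,2) AllI.hyps(3) _ f(2), unfolded fm.map]) (use A in simp)
      have "f c \<notin> csts_fm (ren f D)" if "D \<in> {A, B} \<union> H" for D
        using fresh_ren[OF f(1), of c D] elim that A AllI.hyps by auto
      then show ?thesis unfolding fm.map
        by (intro deriv.AllI[OF d _ Sent]) (use elim f in auto)
    qed
    then show ?case using elim A by auto
  qed
next
  case (AllE H x A c)
  show ?case using AllE.IH eventually_cst_mem[OF \<open>c \<in> csts S1\<close>]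
  proof eventually_elim
    case (elim K)
    then show ?case using csts_subst_subset[of A x c] by (auto intro!: deriv.AllE)
  qed
next
  case (ExI H A x c)
  show ?case using ExI.IH eventually_cst_mem[OF \<open>c \<in> csts S1\<close>]
  proof eventually_elim
    case (elim K)
    have A: "csts_fm A \<subseteq> K" using elim csts_subset_subst[of A x c] by auto
    have "deriv S2 (ren f ` H) (ren f (Ex x A))"
      if f: "inj_on f K" "f ` K \<subseteq> csts S2" for f
    proof -
      have "deriv S2 (ren f ` H) (subst (ren f A) x (Cst (f c)))"
        using elim f by auto
      moreover have "ren f (Ex x A) \<in> Sent S2"
        by (rule ren_Sent[OF S2(1,2) ExI.hyps(3) _ f(2)]) (use A f in auto)
      ultimately show ?thesis unfolding fm.map
        by (intro deriv.ExI) (use elim f in auto)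
    qed
    then show ?case using elim A by auto
  qed
next
  case (ExE H x A H1 C c)
  show ?case using ExE.IH eventually_cst_mem[OF \<open>c \<in> csts S1\<close>]
  proof eventually_elim
    case (elim K)
    have A: "csts_fm A \<subseteq> K" "csts_fm (subst A x (Cst c)) \<subseteq> K"
      using elim csts_subst_subset[of A x c] by auto
    have "deriv S2 (ren f ` (H \<union> (H1 - {subst A x (Cst c)}))) (ren f C)"
      if f: "inj_on f K" "f ` K \<subseteq> csts S2" for f
    proof -
      have eq: "ren f ` (H1 - {subst A x (Cst c)}) = ren f ` H1 - {subst (ren f A) x (Cst (f c))}"
        using ren_mem_Diff[OF f(1), of H1 "subst A x (Cst c)"] elim A by simp
      have fresh: "f c \<notin> csts_fm (ren f D)" if "D \<in> {A, C} \<union> (H1 - {subst A x (Cst c)})" for D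
        using fresh_ren[OF f(1), of c D] elim that A ExE.hyps by auto
      have d: "deriv S2 (ren f ` H) (Ex x (ren f A))" "deriv S2 (ren f ` H1) (ren f C)"
        using elim f by auto
      have "deriv S2 (ren f ` H \<union> (ren f ` H1 - {subst (ren f A) x (Cst (f c))})) (ren f C)"
        by (rule deriv.ExE[OF d])
          (use elim f fresh in \<open>auto simp flip: eq\<close>)
      then show ?thesis unfolding image_Un eq .
    qed
    then show ?case using elim by auto
  qed
next
  case (NegAllI H A x c)
  show ?case using NegAllI.IH eventually_cst_mem[OF \<open>c \<in> csts S1\<close>]
  proof eventually_elim
    case (elim K)
    have A: "csts_fm A \<subseteq> K" using elim csts_subset_subst[of A x c] by auto
    have "deriv S2 (ren f ` H) (ren f (Neg (All x A)))"
      if f: "inj_on f K" "f ` K \<subseteq> csts S2" for f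
    proof -
      have "deriv S2 (ren f ` H) (Neg (subst (ren f A) x (Cst (f c))))"
        using elim f by auto
      moreover have "ren f (All x A) \<in> Sent S2"
        by (rule ren_Sent[OF S2(1,2) NegAllI.hyps(3) _ f(2)]) (use A f in auto)
      ultimately show ?thesis unfolding fm.map
        by (intro deriv.NegAllI) (use elim f in auto)
    qed
    then show ?case using elim A by auto
  qed
next
  case (NegAllE H x A H1 C c)
  show ?case using NegAllE.IH eventually_cst_mem[OF \<open>c \<in> csts S1\<close>]
  proof eventually_elim
    case (elim K)
    have A: "csts_fm A \<subseteq> K" "csts_fm (Neg (subst A x (Cst c))) \<subseteq> K"
      using elim csts_subst_subset[of A x c] by auto
    have "deriv S2 (ren f ` (H \<union> (H1 - {Neg (subst A x (Cst c))}))) (ren f C)"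
      if f: "inj_on f K" "f ` K \<subseteq> csts S2" for f
    proof -
      have eq: "ren f ` (H1 - {Neg (subst A x (Cst c))}) =
          ren f ` H1 - {Neg (subst (ren f A) x (Cst (f c)))}"
        using ren_mem_Diff[OF f(1), of H1 "Neg (subst A x (Cst c))"] elim A by simp
      have fresh: "f c \<notin> csts_fm (ren f D)" if "D \<in> {A, C} \<union> (H1 - {Neg (subst A x (Cst c))})" for D
        using fresh_ren[OF f(1), of c D] elim that A NegAllE.hyps by auto
      have d: "deriv S2 (ren f ` H) (Neg (All x (ren f A)))" "deriv S2 (ren f ` H1) (ren f C)"
        using elim f by auto
      have "deriv S2 (ren f ` H \<union> (ren f ` H1 - {Neg (subst (ren f A) x (Cst (f c)))})) (ren f C)"
        by (rule deriv.NegAllE[OF d])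
          (use elim f fresh in \<open>auto simp flip: eq\<close>)
      then show ?thesis unfolding image_Un eq .
    qed
    then show ?case using elim by auto
  qed
next
  case (NegExI H A x c)
  show ?case using NegExI.IH eventually_cst_mem[OF \<open>c \<in> csts S1\<close>]
  proof eventually_elim
    case (elim K)
    have A: "csts_fm A \<subseteq> K" using elim csts_subset_subst[of A x c] by auto
    have "deriv S2 (ren f ` H) (ren f (Neg (Ex x A)))"
      if f: "inj_on f K" "f ` K \<subseteq> csts S2" for f
    proof -
      have "deriv S2 (ren f ` H) (Neg (subst (ren f A) x (Cst (f c))))"
        using elim f by auto
      moreover have fresh: "f c \<notin> csts_fm (ren f D)" if "D \<in> insert A H" for D
        using fresh_ren[OF f(1), of c D] elim that A NegExI.hyps by auto
      moreover have "ren f (Ex x A) \<in> Sent S2"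
        by (rule ren_Sent[OF S2(1,2) NegExI.hyps(3) _ f(2)]) (use A f in auto)
      ultimately show ?thesis unfolding fm.map
        by (intro deriv.NegExI) (use elim f fresh in auto)
    qed
    then show ?case using elim A by auto
  qed
next
  case (NegExE H x A c)
  show ?case using NegExE.IH eventually_cst_mem[OF \<open>c \<in> csts S1\<close>]
  proof eventually_elim
    case (elim K)
    then show ?case using csts_subst_subset[of A x c] by (auto intro!: deriv.NegExE)
  qed
next
  case (IdI c)
  show ?case using eventually_cst_mem[OF IdI]
  proof eventually_elim
    case (elim K)
    then show ?case using deriv.IdI[of _ S2] S2(3) by (auto simp: Eql_def)
  qed
next
  case (IdE H1 c1 c2 H2 A x)
  have Sent: "Eql S1 c1 c2 \<in> Sent S1"
    using IdE.hyps(1) deriv_Sent S1 by blast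
  show ?case using IdE.IH
  proof eventually_elim
    case (elim K)
    have c: "c1 \<in> K" "c2 \<in> K" using elim by (auto simp: Eql_def)
    have A: "csts_fm A \<subseteq> K" "csts_fm (subst A x (Cst c2)) \<subseteq> K"
      using elim c csts_subst_subset[of A x c2] csts_subset_subst[of A x c1] by auto
    have "deriv S2 (ren f ` (H1 \<union> H2)) (ren f (subst A x (Cst c2)))"
      if f: "inj_on f K" "f ` K \<subseteq> csts S2" for f
    proof -
      have "deriv S2 (ren f ` H1) (Eql S2 (f c1) (f c2))"
        "deriv S2 (ren f ` H2) (subst (ren f A) x (Cst (f c1)))"
        using elim f S2 by (auto simp: Eql_def)
      moreover have "ren f A \<in> Form S2"
        using is_form_ren[OF S2(1,2), of A f] IdE.hyps(3) subset_trans[OF image_mono[OF A(1)] f(2)]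
        by (simp add: Form_def)
      ultimately show ?thesis using IdE.hyps unfolding image_Un
        by (simp add: deriv.IdE)
    qed
    then show ?case using elim A by auto
  qed
qed

section \<open>Provability\<close>

lemma provable_mono: "provable S \<Gamma> A \<Longrightarrow> \<Gamma> \<subseteq> \<Delta> \<Longrightarrow> provable S \<Delta> A"
  by (auto simp: provable_def)

lemma provable_hyp: "A \<in> Sent S \<Longrightarrow> A \<in> \<Gamma> \<Longrightarrow> provable S \<Gamma> A"
  by (auto simp: provable_def intro!: exI[of _ "{A}"] deriv.Hyp)

lemma provable_Sent: "is_signature S \<Longrightarrow> provable S \<Gamma> A \<Longrightarrow> A \<in> Sent S"
  using deriv_Sent by (auto simp: provable_def)

lemma provable_finite: "provable S \<Gamma> A \<Longrightarrow> \<exists>\<Gamma>0. finite \<Gamma>0 \<and> \<Gamma>0 \<subseteq> \<Gamma> \<and> provable S \<Gamma>0 A"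
  unfolding provable_def by (meson deriv_finite subset_refl)

lemma provable_unary:
  assumes "\<And>H. deriv S H A \<Longrightarrow> deriv S H B"
  shows "provable S \<Gamma> A \<Longrightarrow> provable S \<Gamma> B"
  using assms by (auto simp: provable_def)

lemma provable_DisI:
  "provable S \<Gamma> A \<Longrightarrow> B \<in> Sent S \<Longrightarrow> provable S \<Gamma> (Dis A B)"
  "provable S \<Gamma> B \<Longrightarrow> A \<in> Sent S \<Longrightarrow> provable S \<Gamma> (Dis A B)"
  unfolding provable_def by (blast intro: deriv.DisI1 deriv.DisI2)+

lemma provable_ConI: "provable S \<Gamma> A \<Longrightarrow> provable S \<Gamma> B \<Longrightarrow> provable S \<Gamma> (Con A B)"
  unfolding provable_def by (metis Un_least deriv.ConI)

lemma provable_NegDisI: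
  "provable S \<Gamma> (Neg A) \<Longrightarrow> provable S \<Gamma> (Neg B) \<Longrightarrow> provable S \<Gamma> (Neg (Dis A B))"
  unfolding provable_def by (metis Un_least deriv.NegDisI)

lemma provable_DisE:
  assumes "provable S \<Gamma> (Dis A B)" "provable S (insert A \<Gamma>) C" "provable S (insert B \<Gamma>) C"
  shows "provable S \<Gamma> C"
proof -
  obtain H H1 H2 where H: "H \<subseteq> \<Gamma>" "H1 \<subseteq> insert A \<Gamma>" "H2 \<subseteq> insert B \<Gamma>"
    and "deriv S H (Dis A B)" "deriv S H1 C" "deriv S H2 C"
    using assms by (auto simp: provable_def)
  then have "deriv S (H \<union> (H1 - {A}) \<union> (H2 - {B})) C" by (blast intro: deriv.DisE)
  moreover have "H \<union> (H1 - {A}) \<union> (H2 - {B}) \<subseteq> \<Gamma>" using H by auto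
  ultimately show ?thesis unfolding provable_def by blast
qed

lemma provable_NegConE:
  assumes "provable S \<Gamma> (Neg (Con A B))" "provable S (insert (Neg A) \<Gamma>) C"
    "provable S (insert (Neg B) \<Gamma>) C"
  shows "provable S \<Gamma> C"
proof -
  obtain H H1 H2 where H: "H \<subseteq> \<Gamma>" "H1 \<subseteq> insert (Neg A) \<Gamma>" "H2 \<subseteq> insert (Neg B) \<Gamma>"
    and "deriv S H (Neg (Con A B))" "deriv S H1 C" "deriv S H2 C"
    using assms by (auto simp: provable_def)
  then have "deriv S (H \<union> (H1 - {Neg A}) \<union> (H2 - {Neg B})) C" by (blast intro: deriv.NegConE)
  moreover have "H \<union> (H1 - {Neg A}) \<union> (H2 - {Neg B}) \<subseteq> \<Gamma>" using H by auto
  ultimately show ?thesis unfolding provable_def by blast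
qed

text \<open>In the absence of implication, \<or>E applied to \<open>Dis A A\<close> does the work of
  a cut.\<close>

lemma provable_cut:
  assumes "is_signature S" "provable S \<Gamma> A" "provable S (insert A \<Gamma>) C"
  shows "provable S \<Gamma> C"
proof -
  have "provable S \<Gamma> (Dis A A)"
    using assms(2) provable_Sent[OF assms(1,2)] by (rule provable_DisI(1))
  then show ?thesis using assms(3) by (blast intro: provable_DisE)
qed

lemma provable_IdE:
  assumes "provable S \<Gamma> (Eql S c d)" "provable S \<Gamma> (subst A x (Cst c))" "A \<in> Form S" "fv A \<subseteq> {x}"
  shows "provable S \<Gamma> (subst A x (Cst d))"
  using assms unfolding provable_def by (metis Un_least deriv.IdE)

lemma provable_All_Neg:
  assumes S: "is_signature S" and Sent: "Ex x A \<in> Sent S"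
  shows "provable S {All x (Neg A)} (Neg (Ex x A))"
proof -
  obtain c where c: "c \<in> csts S" "c \<notin> csts_fm A"
    using S finite_csts_fm[of A] unfolding is_signature_def by (meson finite_subset subsetI)
  have "deriv S {All x (Neg A)} (All x (Neg A))"
    by (rule deriv.Hyp) (use Sent in \<open>auto simp: Sent_def Form_def\<close>)
  then have "deriv S {All x (Neg A)} (Neg (subst A x (Cst c)))"
    using deriv.AllE[of S _ x "Neg A" c] c by simp
  then have "deriv S {All x (Neg A)} (Neg (Ex x A))"
    by (rule deriv.NegExI) (use c Sent in auto)
  then show ?thesis by (auto simp: provable_def)
qed

section \<open>A multiple-conclusion consequence relation\<close>

text \<open>Nonempty finite disjunctions in any bracketing and with repetitions: the language has no
  falsum to serve as the empty one, and closure under \<open>Dis\<close> makes normal forms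
  unnecessary.\<close>

inductive_set disjs :: "('c, 'p) fm set \<Rightarrow> ('c, 'p) fm set" for U where
  base: "A \<in> U \<Longrightarrow> A \<in> disjs U"
| Dis: "A \<in> disjs U \<Longrightarrow> B \<in> disjs U \<Longrightarrow> Dis A B \<in> disjs U"

lemma disjs_mono: "A \<in> disjs U \<Longrightarrow> U \<subseteq> V \<Longrightarrow> A \<in> disjs V"
  by (induction rule: disjs.induct) (auto intro: disjs.intros)

lemma disjs_finite: "A \<in> disjs U \<Longrightarrow> \<exists>U0. finite U0 \<and> U0 \<subseteq> U \<and> A \<in> disjs U0"
proof (induction rule: disjs.induct)
  case (base A)
  then show ?case by (intro exI[of _ "{A}"]) (auto intro: disjs.base)
next
  case (Dis A B)
  then obtain V W where "finite V" "V \<subseteq> U" "A \<in> disjs V" "finite W" "W \<subseteq> U" "B \<in> disjs W"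
    by blast
  then show ?case
    by (intro exI[of _ "V \<union> W"]) (auto intro: disjs.Dis disjs_mono)
qed

lemma csts_disjs: "A \<in> disjs U \<Longrightarrow> \<forall>B\<in>U. c \<notin> csts_fm B \<Longrightarrow> c \<notin> csts_fm A"
  by (induction rule: disjs.induct) auto

definition conseq :: "('c, 'p) signature \<Rightarrow> ('c, 'p) fm set \<Rightarrow> ('c, 'p) fm set \<Rightarrow> bool" where
  "conseq S \<Gamma> U \<longleftrightarrow> (\<exists>D\<in>disjs U. provable S \<Gamma> D)"

lemma conseq_mono: "conseq S \<Gamma> U \<Longrightarrow> \<Gamma> \<subseteq> \<Delta> \<Longrightarrow> U \<subseteq> V \<Longrightarrow> conseq S \<Delta> V"
  unfolding conseq_def by (meson disjs_mono provable_mono)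

lemma conseq_finite:
  assumes "conseq S \<Gamma> U"
  shows "\<exists>\<Gamma>0 U0. finite \<Gamma>0 \<and> \<Gamma>0 \<subseteq> \<Gamma> \<and> finite U0 \<and> U0 \<subseteq> U \<and> conseq S \<Gamma>0 U0"
  using assms disjs_finite provable_finite unfolding conseq_def by metis

lemma conseq_base: "provable S \<Gamma> A \<Longrightarrow> A \<in> U \<Longrightarrow> conseq S \<Gamma> U"
  unfolding conseq_def by (blast intro: disjs.base)

lemma conseq_hyp: "A \<in> Sent S \<Longrightarrow> A \<in> \<Gamma> \<Longrightarrow> A \<in> U \<Longrightarrow> conseq S \<Gamma> U"
  by (blast intro: conseq_base provable_hyp)

lemma conseq_disjs_cut:
  assumes S: "is_signature S" and V: "\<And>B. B \<in> V \<Longrightarrow> B \<in> Sent S \<Longrightarrow> conseq S (insert B \<Gamma>) U"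
  shows "E \<in> disjs V \<Longrightarrow> E \<in> Sent S \<Longrightarrow> conseq S (insert E \<Gamma>) U"
proof (induction rule: disjs.induct)
  case (base A)
  then show ?case by (rule V)
next
  case (Dis A B)
  then obtain D1 D2 where D: "D1 \<in> disjs U" "D2 \<in> disjs U"
    and p: "provable S (insert A \<Gamma>) D1" "provable S (insert B \<Gamma>) D2"
    by (auto simp: conseq_def)
  have "D1 \<in> Sent S" "D2 \<in> Sent S" using p provable_Sent S by blast+
  \<comment> \<open>The branches may end in different disjunctions; weakening both to
    \<open>Dis D1 D2\<close> gives \<or>E a common conclusion.\<close>
  then have "provable S (insert A \<Gamma>) (Dis D1 D2)" "provable S (insert B \<Gamma>) (Dis D1 D2)"
    using p by (auto intro: provable_DisI)
  then have "provable S (insert A (insert (Dis A B) \<Gamma>)) (Dis D1 D2)"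
    "provable S (insert B (insert (Dis A B) \<Gamma>)) (Dis D1 D2)"
    by (blast intro: provable_mono)+
  then have "provable S (insert (Dis A B) \<Gamma>) (Dis D1 D2)"
    using provable_hyp[OF Dis.prems] by (blast intro: provable_DisE)
  then show ?case using D by (auto simp: conseq_def intro: disjs.Dis)
qed

text \<open>The disjunction proved on the right is split into its leaves: a leaf \<open>A\<close> is
  handled by the assumption with \<open>A\<close> on the left, and a leaf in \<open>U\<close> is
  already an allowed conclusion.\<close>

lemma conseq_cut:
  assumes S: "is_signature S" and "conseq S (insert A \<Gamma>) U" "conseq S \<Gamma> (insert A U)"
  shows "conseq S \<Gamma> U"
proof -
  obtain D where D: "D \<in> disjs (insert A U)" "provable S \<Gamma> D"
    using assms by (auto simp: conseq_def)
  have "conseq S (insert D \<Gamma>) U"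
  proof (rule conseq_disjs_cut[OF S _ D(1) provable_Sent[OF S D(2)]])
    fix B assume "B \<in> insert A U" "B \<in> Sent S"
    then show "conseq S (insert B \<Gamma>) U" using assms(2) by (auto intro: conseq_hyp)
  qed
  then show ?thesis using provable_cut[OF S D(2)] by (auto simp: conseq_def)
qed

lemma conseq_singleton:
  assumes S: "is_signature S" and "conseq S \<Gamma> {A}"
  shows "provable S \<Gamma> A"
proof -
  obtain D where D: "D \<in> disjs {A}" "provable S \<Gamma> D" using assms by (auto simp: conseq_def)
  from D(1) have "D \<in> Sent S \<longrightarrow> provable S {D} A"
  proof (induction rule: disjs.induct)
    case (Dis D E)
    show ?case
    proof
      assume Sent: "Dis D E \<in> Sent S"
      show "provable S {Dis D E} A"
        by (rule provable_DisE[OF provable_hyp[OF Sent]])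
          (use Dis Sent in \<open>auto intro: provable_mono\<close>)
    qed
  qed (auto intro: provable_hyp)
  then show ?thesis using provable_cut[OF S D(2)] provable_Sent[OF S D(2)]
    by (blast intro: provable_mono)
qed

section \<open>Eigenconstant rules with several conclusions\<close>

lemma conseq_ExE:
  assumes S: "is_signature S" and Sent: "Ex x A \<in> Sent S" and c: "c \<in> csts S" "c \<notin> csts_fm A"
    and fresh: "\<forall>B\<in>\<Gamma> \<union> U. c \<notin> csts_fm B"
    and "conseq S (insert (subst A x (Cst c)) \<Gamma>) U"
  shows "conseq S (insert (Ex x A) \<Gamma>) U"
proof -
  obtain D H where D: "D \<in> disjs U" and H: "H \<subseteq> insert (subst A x (Cst c)) \<Gamma>" "deriv S H D"
    using assms by (auto simp: conseq_def provable_def)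
  have cD: "c \<notin> csts_fm D" by (rule csts_disjs[OF D]) (use fresh in auto)
  have "deriv S ({Ex x A} \<union> (H - {subst A x (Cst c)})) D"
    by (rule deriv.ExE[OF deriv.Hyp[OF Sent] H(2)]) (use c cD H fresh in auto)
  moreover have "{Ex x A} \<union> (H - {subst A x (Cst c)}) \<subseteq> insert (Ex x A) \<Gamma>" using H by auto
  ultimately show ?thesis using D unfolding conseq_def provable_def by blast
qed

lemma conseq_NegAllE:
  assumes S: "is_signature S" and Sent: "Neg (All x A) \<in> Sent S"
    and c: "c \<in> csts S" "c \<notin> csts_fm A"
    and fresh: "\<forall>B\<in>\<Gamma> \<union> U. c \<notin> csts_fm B"
    and "conseq S (insert (Neg (subst A x (Cst c))) \<Gamma>) U"
  shows "conseq S (insert (Neg (All x A)) \<Gamma>) U"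
proof -
  obtain D H where D: "D \<in> disjs U" and H: "H \<subseteq> insert (Neg (subst A x (Cst c))) \<Gamma>" "deriv S H D"
    using assms by (auto simp: conseq_def provable_def)
  have cD: "c \<notin> csts_fm D" by (rule csts_disjs[OF D]) (use fresh in auto)
  have "deriv S ({Neg (All x A)} \<union> (H - {Neg (subst A x (Cst c))})) D"
    by (rule deriv.NegAllE[OF deriv.Hyp[OF Sent] H(2)]) (use c cD H fresh in auto)
  moreover have "{Neg (All x A)} \<union> (H - {Neg (subst A x (Cst c))}) \<subseteq> insert (Neg (All x A)) \<Gamma>"
    using H by auto
  ultimately show ?thesis using D unfolding conseq_def provable_def by blast
qed

text \<open>\<forall>I wants the instance as right disjunct and no \<open>c\<close> on the left,
  whereas the given disjunction may have the instance at any of its leaves. It is therefore first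
  weakened to some \<open>Dis E (subst A x (Cst c))\<close> with \<open>c\<close> absent from
  \<open>E\<close>.\<close>

lemma conseq_AllI:
  assumes S: "is_signature S" and Sent: "All x A \<in> Sent S" and c: "c \<in> csts S" "c \<notin> csts_fm A"
    and fresh: "\<forall>B\<in>\<Gamma> \<union> U. c \<notin> csts_fm B"
    and "conseq S \<Gamma> (insert (subst A x (Cst c)) U)"
  shows "conseq S \<Gamma> (insert (All x A) U)"
proof -
  let ?A = "subst A x (Cst c)"
  obtain D where D: "D \<in> disjs (insert ?A U)" "provable S \<Gamma> D"
    using assms by (auto simp: conseq_def)
  have A: "?A \<in> Sent S" using Sent c by (simp add: subst_Sent)
  from D(1) have "D \<in> Sent S \<longrightarrow> (\<exists>E\<in>disjs (insert (All x A) U). c \<notin> csts_fm E \<and> E \<in> Sent S \<and>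
    provable S {D} (Dis E ?A))"
  proof (induction rule: disjs.induct)
    case (base B)
    \<comment> \<open>Moving the instance to the right could leave nothing on the left;
      \<open>All x A\<close>, which lacks \<open>c\<close> and is an allowed conclusion, fills the
      gap.\<close>
    have "provable S {?A} (Dis (All x A) ?A)"
      by (intro provable_DisI(2) provable_hyp) (use A Sent in auto)
    moreover have "B \<in> Sent S \<Longrightarrow> provable S {B} (Dis B ?A)"
      by (intro provable_DisI(1) provable_hyp) (use A in auto)
    ultimately show ?case using base fresh Sent c
      by (cases "B = ?A") (force intro: disjs.base)+
  next
    case (Dis D1 D2)
    show ?case
    proof
      assume D12: "Dis D1 D2 \<in> Sent S"
      then obtain E1 E2 where
        E1: "E1 \<in> disjs (insert (All x A) U)" "c \<notin> csts_fm E1" "E1 \<in> Sent S" "provable S {D1} (Dis E1 ?A)" and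
        E2: "E2 \<in> disjs (insert (All x A) U)" "c \<notin> csts_fm E2" "E2 \<in> Sent S" "provable S {D2} (Dis E2 ?A)"
        using Dis by auto
      let ?C = "Dis (Dis E1 E2) ?A"
      have I: "E1 \<in> \<Gamma> \<Longrightarrow> provable S \<Gamma> ?C" "E2 \<in> \<Gamma> \<Longrightarrow> provable S \<Gamma> ?C"
        "?A \<in> \<Gamma> \<Longrightarrow> provable S \<Gamma> ?C" for \<Gamma>
        using E1 E2 A provable_hyp[of E1 S \<Gamma>] provable_hyp[of E2 S \<Gamma>] provable_hyp[of ?A S \<Gamma>]
        by (simp_all add: provable_DisI)
      have "provable S {D1, Dis D1 D2} ?C"
        by (rule provable_DisE[OF provable_mono[OF E1(4)]]) (use I in auto)
      moreover have "provable S {D2, Dis D1 D2} ?C"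
        by (rule provable_DisE[OF provable_mono[OF E2(4)]]) (use I in auto)
      ultimately have "provable S {Dis D1 D2} ?C"
        using provable_DisE[OF provable_hyp[OF D12]] by blast
      then show "\<exists>E\<in>disjs (insert (All x A) U). c \<notin> csts_fm E \<and> E \<in> Sent S \<and>
          provable S {Dis D1 D2} (Dis E ?A)"
        using E1 E2 by (intro bexI[of _ "Dis E1 E2"]) (auto intro: disjs.Dis)
    qed
  qed
  then obtain E where E: "E \<in> disjs (insert (All x A) U)" "c \<notin> csts_fm E" "E \<in> Sent S"
    "provable S {D} (Dis E ?A)" using provable_Sent[OF S D(2)] by blast
  have "provable S \<Gamma> (Dis E ?A)"
    by (rule provable_cut[OF S D(2) provable_mono[OF E(4)]]) auto
  then obtain H where H: "H \<subseteq> \<Gamma>" "deriv S H (Dis E ?A)" by (auto simp: provable_def)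
  have "deriv S H (Dis E (All x A))"
    by (rule deriv.AllI[OF H(2) c(1) Sent c(2) E(2)]) (use H fresh in auto)
  moreover have "Dis E (All x A) \<in> disjs (insert (All x A) U)"
    using E by (auto intro: disjs.intros)
  ultimately show ?thesis using H by (auto simp: conseq_def provable_def)
qed

lemma conseq_NegExI:
  assumes S: "is_signature S" and Sent: "Neg (Ex x A) \<in> Sent S"
    and c: "c \<in> csts S" "c \<notin> csts_fm A"
    and fresh: "\<forall>B\<in>\<Gamma> \<union> U. c \<notin> csts_fm B"
    and "conseq S \<Gamma> (insert (Neg (subst A x (Cst c))) U)"
  shows "conseq S \<Gamma> (insert (Neg (Ex x A)) U)"
proof (rule conseq_cut[OF S, of "All x (Neg A)"])
  have "provable S (insert (All x (Neg A)) \<Gamma>) (Neg (Ex x A))"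
    using provable_All_Neg[OF S, of x A] Sent by (auto intro: provable_mono)
  then show "conseq S (insert (All x (Neg A)) \<Gamma>) (insert (Neg (Ex x A)) U)"
    by (rule conseq_base) simp
  have "conseq S \<Gamma> (insert (All x (Neg A)) U)"
    by (rule conseq_AllI[OF S _ c(1) _ fresh]) (use assms in \<open>auto simp: Sent_def Form_def\<close>)
  then show "conseq S \<Gamma> (insert (All x (Neg A)) (insert (Neg (Ex x A)) U))"
    by (rule conseq_mono) auto
qed

section \<open>Witnesses\<close>

text \<open>A witness \<open>c\<close> for the quantified sentence \<open>\<phi>\<close> turns into the sequent
  \<open>wit_ant \<phi> c \<turnstile> wit_suc \<phi> c\<close>, which is the converse of an instantiation rule; it is trivial
  for all other \<open>\<phi>\<close>.\<close>

fun wit_ant :: "('c, 'p) fm \<Rightarrow> 'c \<Rightarrow> ('c, 'p) fm" where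
  "wit_ant (All x A) c = subst A x (Cst c)"
| "wit_ant (Neg (Ex x A)) c = Neg (subst A x (Cst c))"
| "wit_ant A c = A"

fun wit_suc :: "('c, 'p) fm \<Rightarrow> 'c \<Rightarrow> ('c, 'p) fm" where
  "wit_suc (Ex x A) c = subst A x (Cst c)"
| "wit_suc (Neg (All x A)) c = Neg (subst A x (Cst c))"
| "wit_suc A c = A"

lemma csts_wit:
  "csts_fm (wit_ant A c) \<subseteq> insert c (csts_fm A)" "csts_fm (wit_suc A c) \<subseteq> insert c (csts_fm A)"
  by (induction A c rule: wit_ant.induct) (auto dest: csts_subst_subset[THEN subsetD])

lemma wit_Sent:
  assumes "A \<in> Sent S" "c \<in> csts S"
  shows "wit_ant A c \<in> Sent S" "wit_suc A c \<in> Sent S"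
  using assms
  by (induction A c rule: wit_ant.induct) (simp_all add: subst_Sent)

text \<open>A fresh witness for one sentence is conservative: at most one of
  \<open>wit_ant A c\<close> and \<open>wit_suc A c\<close> differs from \<open>A\<close>, the
  matching eigenconstant rule turns it back into \<open>A\<close>, and \<open>A\<close> is
  cut.\<close>

lemma conseq_witness:
  assumes S: "is_signature S" and A: "A \<in> Sent S" and c: "c \<in> csts S" "c \<notin> csts_fm A"
    and fresh: "\<forall>B\<in>\<Gamma> \<union> U. c \<notin> csts_fm B"
    and ant: "conseq S \<Gamma> (insert (wit_ant A c) U)" and suc: "conseq S (insert (wit_suc A c) \<Gamma>) U"
  shows "conseq S \<Gamma> U"
proof -
  have "conseq S \<Gamma> (insert A U)"
  proof (cases "(A, c)" rule: wit_ant.cases)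
    case (1 x B d)
    then show ?thesis using conseq_AllI[OF S _ c(1) _ fresh] A c ant by simp
  next
    case (2 x B d)
    then show ?thesis using conseq_NegExI[OF S _ c(1) _ fresh] A c ant by simp
  qed (use ant in auto)
  moreover have "conseq S (insert A \<Gamma>) U"
  proof (cases "(A, c)" rule: wit_suc.cases)
    case (1 x B d)
    then show ?thesis using conseq_ExE[OF S _ c(1) _ fresh] A c suc by simp
  next
    case (2 x B d)
    then show ?thesis using conseq_NegAllE[OF S _ c(1) _ fresh] A c suc by simp
  qed (use suc in auto)
  ultimately show ?thesis using conseq_cut[OF S] by blast
qed

section \<open>Lindenbaum's lemma\<close>

text \<open>Zorn's lemma maximises the accepted set with only \<open>U\<close> excluded; cut then
  allows its whole complement to be excluded as well.\<close>

lemma lindenbaum: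
  fixes R :: "'a set \<Rightarrow> 'a set \<Rightarrow> bool"
  assumes mono: "\<And>T U T' U'. R T U \<Longrightarrow> T \<subseteq> T' \<Longrightarrow> U \<subseteq> U' \<Longrightarrow> R T' U'"
    and fin: "\<And>T U. R T U \<Longrightarrow> \<exists>T0 U0. finite T0 \<and> T0 \<subseteq> T \<and> finite U0 \<and> U0 \<subseteq> U \<and> R T0 U0"
    and cut: "\<And>A T U. R (insert A T) U \<Longrightarrow> R T (insert A U) \<Longrightarrow> R T U"
    and "\<not> R T U"
  shows "\<exists>T'. T \<subseteq> T' \<and> \<not> R T' (U \<union> - T')"
proof -
  let ?A = "{T'. T \<subseteq> T' \<and> \<not> R T' U}"
  have "\<exists>M\<in>?A. \<forall>X\<in>?A. M \<subseteq> X \<longrightarrow> X = M"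
  proof (rule subset_Zorn_nonempty)
    show "?A \<noteq> {}" using assms(4) by auto
  next
    fix C assume C: "C \<noteq> {}" "subset.chain ?A C"
    then have sub: "C \<subseteq> ?A" by (simp add: subset.chain_def)
    have "\<not> R (\<Union>C) U"
    proof
      assume "R (\<Union>C) U"
      then obtain T0 U0 where T0: "finite T0" "T0 \<subseteq> \<Union>C" "U0 \<subseteq> U" "R T0 U0"
        using fin[of "\<Union>C" U] by blast
      obtain B where "B \<in> C" "T0 \<subseteq> B" using finite_subset_Union_chain[OF T0(1,2) C] .
      then have "R B U" using mono[OF T0(4) _ T0(3)] by blast
      then show False using sub \<open>B \<in> C\<close> by blast
    qed
    moreover have "T \<subseteq> \<Union>C" using C(1) sub by blast
    ultimately show "\<Union>C \<in> ?A" by simp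
  qed
  then obtain M where "M \<in> ?A" and max: "\<forall>X\<in>?A. M \<subseteq> X \<longrightarrow> X = M" ..
  then have M: "T \<subseteq> M" "\<not> R M U" by simp_all
  \<comment> \<open>Rejected elements are added one by one: maximality gives
    \<open>R (insert A M) U\<close> for \<open>A\<close> outside \<open>M\<close>, so by cut adding
    \<open>A\<close> on the right cannot make \<open>R\<close> hold.\<close>
  have "\<not> R M (U \<union> V)" if "finite V" "V \<subseteq> - M" for V
    using that
  proof (induction V rule: finite_induct)
    case (insert A V)
    have "R (insert A M) U"
    proof (rule ccontr)
      assume "\<not> R (insert A M) U"
      then have "insert A M \<in> ?A" using M(1) by auto
      then have "insert A M = M" using bspec[OF max, of "insert A M"] by blast
      then show False using insert.prems by blast
    qed
    then have "R (insert A M) (U \<union> V)" by (rule mono) auto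
    then show ?case using cut[of A M "U \<union> V"] insert by auto
  qed (simp add: M)
  moreover have "\<exists>V. finite V \<and> V \<subseteq> - M \<and> R M (U \<union> V)" if R: "R M (U \<union> - M)"
  proof -
    obtain T0 U0 where U0: "T0 \<subseteq> M" "finite U0" "U0 \<subseteq> U \<union> - M" "R T0 U0"
      using fin[OF R] by blast
    have "R M (U \<union> (U0 - U))" by (rule mono[OF U0(4) U0(1)]) auto
    then show ?thesis using U0 by (intro exI[of _ "U0 - U"]) auto
  qed
  ultimately have "\<not> R M (U \<union> - M)" by blast
  with M(1) show ?thesis by blast
qed

section \<open>Adjoining witnesses\<close>

text \<open>The type is a fixed point: every sentence over the extended signature already has its own
  witness constant in it, so that no iteration of the extension is needed.\<close>

datatype (orig_csts: 'c, orig_preds: 'p) wcst = Orig 'c | Wit "(('c, 'p) wcst, 'p) fm"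

text \<open>Only the original symbols inside \<open>h\<close> are bounded: asking the formula in
  \<open>Wit\<close> to be a sentence of \<open>wit_sig S\<close> would be circular. The bound on
  predicate letters later keeps the codes of witnesses formulas of \<open>S\<close>.\<close>

definition wit_sig :: "('c, 'p) signature \<Rightarrow> (('c, 'p) wcst, 'p) signature" where
  "wit_sig S = \<lparr>csts = {h. orig_csts h \<subseteq> csts S \<and> orig_preds h \<subseteq> preds S},
     preds = preds S, arity = arity S, ident = ident S\<rparr>"

lemma wit_sig_simps [simp]:
  "preds (wit_sig S) = preds S" "arity (wit_sig S) = arity S" "ident (wit_sig S) = ident S"
  "Orig c \<in> csts (wit_sig S) \<longleftrightarrow> c \<in> csts S"
  by (auto simp: wit_sig_def)

lemma is_signature_wit_sig: "is_signature S \<Longrightarrow> is_signature (wit_sig S)"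
proof -
  assume S: "is_signature S"
  have "Orig ` csts S \<subseteq> csts (wit_sig S)" by auto
  moreover have "infinite (Orig ` csts S)"
    using S by (simp add: is_signature_def finite_image_iff inj_on_def)
  ultimately show ?thesis using S by (auto simp: is_signature_def dest: finite_subset)
qed

lemma Wit_mem: "A \<in> Sent (wit_sig S) \<Longrightarrow> Wit A \<in> csts (wit_sig S)"
  using csts_Sent[of A "wit_sig S"] preds_is_form[of "wit_sig S" A]
  by (fastforce simp: wit_sig_def Sent_def Form_def)

text \<open>Nesting depth of witnesses; the inserted 0 covers formulas without constants, where
  \<open>Max\<close> would be unspecified.\<close>

primrec wrank :: "('c, 'p) wcst \<Rightarrow> nat" where
  "wrank (Orig c) = 0"
| "wrank (Wit A) = Suc (Max (insert 0 (csts_fm (map_fm wrank (\<lambda>p. p) A))))"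

text \<open>Source of freshness: \<open>Wit A\<close> occurs neither in \<open>A\<close> nor in any
  \<open>B\<close> whose witness has no larger rank.\<close>

lemma wrank_less: "h \<in> csts_fm A \<Longrightarrow> wrank h < wrank (Wit A)"
  using finite_csts_fm[of A] by (auto simp: fm.set_map less_Suc_eq_le intro!: Max_ge)

section \<open>Consequence modulo witness sequents\<close>

abbreviation ant :: "(('c, 'p) wcst, 'p) fm \<Rightarrow> (('c, 'p) wcst, 'p) fm" where
  "ant A \<equiv> wit_ant A (Wit A)"

abbreviation suc :: "(('c, 'p) wcst, 'p) fm \<Rightarrow> (('c, 'p) wcst, 'p) fm" where
  "suc A \<equiv> wit_suc A (Wit A)"

text \<open>Consequence modulo finitely many witness sequents \<open>ant A \<turnstile> suc A\<close>.  As there is no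
  implication in the language, these cannot be hypotheses; instead, each of them is
  cut in on either side.\<close>

definition conseq_wit ::
    "('c, 'p) signature \<Rightarrow> (('c, 'p) wcst, 'p) fm set \<Rightarrow> (('c, 'p) wcst, 'p) fm set \<Rightarrow> bool" where
  "conseq_wit S \<Gamma> U \<longleftrightarrow> (\<exists>F. finite F \<and> F \<subseteq> Sent (wit_sig S) \<and>
     (\<forall>G\<subseteq>F. conseq (wit_sig S) (\<Gamma> \<union> suc ` G) (U \<union> ant ` (F - G))))"

lemma conseq_witI:
  assumes "finite F" "F \<subseteq> Sent (wit_sig S)"
    and "\<And>G. G \<subseteq> F \<Longrightarrow> conseq (wit_sig S) (\<Gamma> \<union> suc ` G) (U \<union> ant ` (F - G))"
  shows "conseq_wit S \<Gamma> U"
  unfolding conseq_wit_def by (intro exI[of _ F] conjI allI impI assms)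

lemma conseq_witE:
  assumes "conseq_wit S \<Gamma> U"
  obtains F where "finite F" "F \<subseteq> Sent (wit_sig S)"
    "\<And>G. G \<subseteq> F \<Longrightarrow> conseq (wit_sig S) (\<Gamma> \<union> suc ` G) (U \<union> ant ` (F - G))"
  using assms unfolding conseq_wit_def by (elim exE conjE) simp

lemma conseq_wit_base: "conseq (wit_sig S) \<Gamma> U \<Longrightarrow> conseq_wit S \<Gamma> U"
  unfolding conseq_wit_def by (intro exI[of _ "{}"]) auto

lemma conseq_wit_mono: "conseq_wit S \<Gamma> U \<Longrightarrow> \<Gamma> \<subseteq> \<Delta> \<Longrightarrow> U \<subseteq> V \<Longrightarrow> conseq_wit S \<Delta> V"
  unfolding conseq_wit_def by (meson Un_mono conseq_mono subset_refl)

text \<open>A finite \<open>F\<close> has finitely many splits \<open>G\<close>, and each needs only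
  finitely many premises and conclusions.\<close>

lemma conseq_wit_finite:
  assumes "conseq_wit S \<Gamma> U"
  shows "\<exists>\<Gamma>0 U0. finite \<Gamma>0 \<and> \<Gamma>0 \<subseteq> \<Gamma> \<and> finite U0 \<and> U0 \<subseteq> U \<and> conseq_wit S \<Gamma>0 U0"
proof -
  obtain F where F: "finite F" "F \<subseteq> Sent (wit_sig S)"
    and c: "\<And>G. G \<subseteq> F \<Longrightarrow> conseq (wit_sig S) (\<Gamma> \<union> suc ` G) (U \<union> ant ` (F - G))"
    by (rule conseq_witE[OF assms], rule that)
  define Q where "Q G \<Gamma>0 U0 \<longleftrightarrow> finite \<Gamma>0 \<and> \<Gamma>0 \<subseteq> \<Gamma> \<union> suc ` G \<and> finite U0 \<and>
      U0 \<subseteq> U \<union> ant ` (F - G) \<and> conseq (wit_sig S) \<Gamma>0 U0" for G \<Gamma>0 U0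
  have "\<forall>G\<in>Pow F. \<exists>\<Gamma>0 U0. Q G \<Gamma>0 U0"
    using conseq_finite[OF c] unfolding Q_def by simp
  then obtain g u where gu: "\<And>G. G \<in> Pow F \<Longrightarrow> Q G (g G) (u G)" by metis
  let ?\<Gamma> = "\<Union>G\<in>Pow F. g G \<inter> \<Gamma>" and ?U = "\<Union>G\<in>Pow F. u G \<inter> U"
  have "conseq (wit_sig S) (?\<Gamma> \<union> suc ` G) (?U \<union> ant ` (F - G))" if "G \<subseteq> F" for G
  proof -
    have Q: "conseq (wit_sig S) (g G) (u G)" "g G \<subseteq> \<Gamma> \<union> suc ` G" "u G \<subseteq> U \<union> ant ` (F - G)"
      using gu[of G] that by (simp_all add: Q_def)
    have "g G \<inter> \<Gamma> \<subseteq> ?\<Gamma>" "u G \<inter> U \<subseteq> ?U" using that by blast+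
    with Q(2,3) have "g G \<subseteq> ?\<Gamma> \<union> suc ` G" "u G \<subseteq> ?U \<union> ant ` (F - G)" by fast+
    with Q(1) show ?thesis by (rule conseq_mono)
  qed
  then have "conseq_wit S ?\<Gamma> ?U" by (rule conseq_witI[OF F])
  moreover have "finite ?\<Gamma>" "finite ?U" using F(1) gu by (simp_all add: Q_def)
  moreover have "?\<Gamma> \<subseteq> \<Gamma>" "?U \<subseteq> U" by blast+
  ultimately show ?thesis by (intro exI[of _ ?\<Gamma>] exI[of _ ?U]) simp
qed

text \<open>Both sides are carried to \<open>F1 \<union> F2\<close>, since every split of the union
  restricts to a split of each part.\<close>

lemma conseq_wit_cut:
  assumes S: "is_signature S" and "conseq_wit S (insert A \<Gamma>) U" "conseq_wit S \<Gamma> (insert A U)"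
  shows "conseq_wit S \<Gamma> U"
proof -
  obtain F1 where F1: "finite F1" "F1 \<subseteq> Sent (wit_sig S)"
    and c1: "\<And>G. G \<subseteq> F1 \<Longrightarrow> conseq (wit_sig S) (insert A \<Gamma> \<union> suc ` G) (U \<union> ant ` (F1 - G))"
    by (rule conseq_witE[OF assms(2)], rule that)
  obtain F2 where F2: "finite F2" "F2 \<subseteq> Sent (wit_sig S)"
    and c2: "\<And>G. G \<subseteq> F2 \<Longrightarrow> conseq (wit_sig S) (\<Gamma> \<union> suc ` G) (insert A U \<union> ant ` (F2 - G))"
    by (rule conseq_witE[OF assms(3)], rule that)
  have c: "conseq (wit_sig S) (\<Gamma> \<union> suc ` G) (U \<union> ant ` (F1 \<union> F2 - G))" for G
  proof (rule conseq_cut[OF is_signature_wit_sig[OF S], where A = A])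
    have "conseq (wit_sig S) (insert A \<Gamma> \<union> suc ` G) (U \<union> ant ` (F1 \<union> F2 - G))"
      by (rule conseq_mono[OF c1[of "G \<inter> F1"]]; (intro Un_mono image_mono)?) blast+
    then show "conseq (wit_sig S) (insert A (\<Gamma> \<union> suc ` G)) (U \<union> ant ` (F1 \<union> F2 - G))"
      by simp
    have "conseq (wit_sig S) (\<Gamma> \<union> suc ` G) (insert A U \<union> ant ` (F1 \<union> F2 - G))"
      by (rule conseq_mono[OF c2[of "G \<inter> F2"]]; (intro Un_mono image_mono)?) blast+
    then show "conseq (wit_sig S) (\<Gamma> \<union> suc ` G) (insert A (U \<union> ant ` (F1 \<union> F2 - G)))"
      by simp
  qed
  show ?thesis by (rule conseq_witI[OF _ _ c]) (use F1 F2 in simp_all)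
qed

text \<open>With \<open>F = {A}\<close>, either \<open>suc A\<close> joins the premises and is also
  a conclusion, or \<open>ant A\<close> joins the conclusions and is also a premise.\<close>

lemma conseq_wit_ant_suc:
  assumes "A \<in> Sent (wit_sig S)"
  shows "conseq_wit S {ant A} {suc A}"
proof -
  have Sent: "ant A \<in> Sent (wit_sig S)" "suc A \<in> Sent (wit_sig S)"
    using assms by (simp_all add: wit_Sent Wit_mem)
  have c: "conseq (wit_sig S) ({ant A} \<union> suc ` G) ({suc A} \<union> ant ` ({A} - G))" for G
  proof (cases "A \<in> G")
    case True
    then show ?thesis by (intro conseq_hyp[OF Sent(2)] UnI1 UnI2 imageI) simp_all
  next
    case False
    then show ?thesis by (intro conseq_hyp[OF Sent(1)]) simp_all
  qed
  show ?thesis by (rule conseq_witI[OF _ _ c]) (use assms in simp_all)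
qed

text \<open>The witness sequents are eliminated in the order of decreasing rank, since the witness of a
  sentence of maximal rank does not occur in the others.\<close>

lemma conseq_wit_conservative:
  assumes S: "is_signature S" and fresh: "\<And>A B. B \<in> \<Gamma> \<union> U \<Longrightarrow> Wit A \<notin> csts_fm B"
    and "conseq_wit S \<Gamma> U"
  shows "conseq (wit_sig S) \<Gamma> U"
proof (rule ccontr)
  assume n: "\<not> conseq (wit_sig S) \<Gamma> U"
  obtain F where F: "finite F" "F \<subseteq> Sent (wit_sig S)"
    and c: "\<And>G. G \<subseteq> F \<Longrightarrow> conseq (wit_sig S) (\<Gamma> \<union> suc ` G) (U \<union> ant ` (F - G))"
    by (rule conseq_witE[OF assms(3)], rule that)
  \<comment> \<open>Underivability is propagated instead: sentences enter by increasing rank, and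
    each goes to a side that keeps the sequent underivable.\<close>
  from F have "\<exists>G\<subseteq>F. \<not> conseq (wit_sig S) (\<Gamma> \<union> suc ` G) (U \<union> ant ` (F - G))"
  proof (induction F rule: finite_ranking_induct[where f = "\<lambda>A. wrank (Wit A)"])
    case (insert A F)
    then obtain G where G: "G \<subseteq> F" "\<not> conseq (wit_sig S) (\<Gamma> \<union> suc ` G) (U \<union> ant ` (F - G))"
      by blast
    show ?case
    proof (cases "A \<in> F")
      case True
      then show ?thesis using G by (auto simp: insert_absorb)
    next
      case False
      have Wit: "Wit A \<notin> csts_fm B" if "B \<in> insert A F" for B
        using wrank_less[of "Wit A" B] insert.hyps(2)[of B] that
        by (auto simp del: wrank.simps)
      have "Wit A \<notin> insert (Wit B) (csts_fm B)" if "B \<in> F" for B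
        using Wit[of B] that False by auto
      then have "Wit A \<notin> csts_fm (suc B)" "Wit A \<notin> csts_fm (ant B)" if "B \<in> F" for B
        using csts_wit[of B "Wit B"] that by blast+
      then have fr: "\<forall>B\<in>(\<Gamma> \<union> suc ` G) \<union> (U \<union> ant ` (F - G)). Wit A \<notin> csts_fm B"
        using fresh G(1) by blast
      have A: "A \<in> Sent (wit_sig S)" using insert.prems by simp
      have "\<not> conseq (wit_sig S) (\<Gamma> \<union> suc ` G) (insert (ant A) (U \<union> ant ` (F - G))) \<or>
        \<not> conseq (wit_sig S) (insert (suc A) (\<Gamma> \<union> suc ` G)) (U \<union> ant ` (F - G))"
        using conseq_witness[OF is_signature_wit_sig[OF S] A Wit_mem[OF A] Wit[of A] fr] G(2)
        by blast
      then show ?thesis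
      proof
        assume "\<not> conseq (wit_sig S) (\<Gamma> \<union> suc ` G) (insert (ant A) (U \<union> ant ` (F - G)))"
        moreover have "insert A F - G = insert A (F - G)" using False G by auto
        ultimately show ?thesis using G(1) by (intro exI[of _ G]) (simp add: subset_insertI2)
      next
        assume "\<not> conseq (wit_sig S) (insert (suc A) (\<Gamma> \<union> suc ` G)) (U \<union> ant ` (F - G))"
        moreover have "insert A F - insert A G = F - G" using False by auto
        ultimately show ?thesis using G(1) by (intro exI[of _ "insert A G"]) (simp add: subset_insertI2)
      qed
    qed
  qed (use n in auto)
  then show False using c by blast
qed

section \<open>Return to the original signature\<close>

lemma ex_inj_on_into_infinite:
  assumes "finite W" "infinite X"
  shows "\<exists>g. inj_on g W \<and> g ` W \<subseteq> X"
proof -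
  obtain Y where "finite Y" "card Y = card W" "Y \<subseteq> X"
    using infinite_arbitrarily_large[OF assms(2)] by blast
  then show ?thesis using finite_same_card_bij[OF assms(1)] by (metis bij_betw_def)
qed

text \<open>Among the infinitely many constants of \<open>S\<close>, the finitely many witnesses in
  one derivation find injective replacements that avoid the original constants used there. The
  latter stay fixed, so \<Gamma> and \<open>A\<close> are restored unchanged.\<close>

lemma provable_wit_sig_conservative:
  fixes S :: "('c, 'p) signature"
  assumes S: "is_signature S" and p: "provable (wit_sig S) (ren Orig ` \<Gamma>) (ren Orig A)"
  shows "provable S \<Gamma> A"
proof -
  obtain H where H: "H \<subseteq> ren Orig ` \<Gamma>" "deriv (wit_sig S) H (ren Orig A)"
    using p by (auto simp: provable_def)
  obtain K where K: "finite K" "K \<subseteq> csts (wit_sig S)"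
    and d: "\<And>f. inj_on f K \<Longrightarrow> f ` K \<subseteq> csts S \<Longrightarrow> deriv S (ren f ` H) (ren f (ren Orig A))"
    using deriv_ren[OF is_signature_wit_sig[OF S] _ _ _ H(2), of S]
    unfolding eventually_finite_subsets_at_top by auto
  have "finite {c. Orig c \<in> K}"
    using finite_vimageI[OF K(1), of Orig] by (simp add: inj_on_def vimage_def)
  then have "infinite (csts S - {c. Orig c \<in> K})" using S by (simp add: is_signature_def)
  then obtain g where g: "inj_on g K" "g ` K \<subseteq> csts S - {c. Orig c \<in> K}"
    using ex_inj_on_into_infinite[OF K(1)] by blast
  define f where "f h = (case h of Orig c \<Rightarrow> c | Wit _ \<Rightarrow> g h)" for h
  have "inj_on f K"
    using g by (intro inj_onI) (auto simp: f_def image_subset_iff inj_on_eq_iff split: wcst.splits)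
  moreover have "f ` K \<subseteq> csts S"
  proof -
    have "c \<in> csts S" if "Orig c \<in> K" for c using K(2) that by force
    then show ?thesis using g(2) by (auto simp: f_def image_subset_iff split: wcst.splits)
  qed
  moreover have f: "ren f (ren Orig B) = B" for B :: "('c, 'p) fm"
    by (simp add: fm.map_comp o_def f_def fm.map_ident)
  ultimately have "deriv S (ren f ` H) A" using d[of f] by simp
  moreover have "ren f ` H \<subseteq> \<Gamma>" using image_mono[OF H(1), of "ren f"] f by (simp add: image_image)
  ultimately show ?thesis by (auto simp: provable_def)
qed

section \<open>Canonical structures\<close>

text \<open>Gluts and gaps of negation are both allowed. \<open>witness\<close> reads a witness
  sequent as closure of \<open>T\<close>: for \<forall> and \<not>\<exists> it leads from an
  instance to the quantified sentence, for \<exists> and \<not>\<forall> from that sentence to an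
  instance.\<close>

locale witnessed_theory =
  fixes S :: "('c, 'p) signature" and T :: "('c, 'p) fm set"
  assumes sig: "is_signature S"
    and T_Sent: "T \<subseteq> Sent S"
    and closed: "provable S T A \<Longrightarrow> A \<in> T"
    and prime: "Dis A B \<in> T \<Longrightarrow> A \<in> T \<or> B \<in> T"
    and witness: "A \<in> Sent S \<Longrightarrow> \<exists>c\<in>csts S. wit_ant A c \<in> T \<longrightarrow> wit_suc A c \<in> T"

lemma ex_witnessed_theory:
  assumes S: "is_signature S" and Sent: "\<Gamma> \<union> {A} \<subseteq> Sent S" and n: "\<not> provable S \<Gamma> A"
  shows "\<exists>T. witnessed_theory (wit_sig S) T \<and> ren Orig ` \<Gamma> \<subseteq> T \<and> ren Orig A \<notin> T"
proof -
  note S' = is_signature_wit_sig[OF S]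
  have Orig: "ren Orig B \<in> Sent (wit_sig S)" if "B \<in> Sent S" for B
    by (rule ren_Sent[OF _ _ that csts_Sent[OF that]]) auto
  have "\<not> conseq (wit_sig S) (ren Orig ` \<Gamma>) {ren Orig A}"
    using n provable_wit_sig_conservative[OF S] conseq_singleton[OF S'] by blast
  then have "\<not> conseq_wit S (ren Orig ` \<Gamma>) {ren Orig A}"
    by (rule contrapos_nn) (rule conseq_wit_conservative[OF S], auto simp: fm.set_map)
  with conseq_wit_mono conseq_wit_finite conseq_wit_cut[OF S]
  have "\<exists>M. ren Orig ` \<Gamma> \<subseteq> M \<and> \<not> conseq_wit S M ({ren Orig A} \<union> - M)"
    by (rule lindenbaum)
  then obtain M where M: "ren Orig ` \<Gamma> \<subseteq> M" "\<not> conseq_wit S M ({ren Orig A} \<union> - M)"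
    by blast
  have nM: "\<not> conseq (wit_sig S) M' U" if "M' \<subseteq> M" "U \<subseteq> {ren Orig A} \<union> - M" for M' U
    using M(2) conseq_wit_mono[OF conseq_wit_base that] by blast
  \<comment> \<open>\<open>M\<close> was maximised among arbitrary sets of formulas, ill-formed or
    open ones included.\<close>
  let ?T = "M \<inter> Sent (wit_sig S)"
  have "witnessed_theory (wit_sig S) ?T"
  proof
    show "A \<in> ?T" if "provable (wit_sig S) ?T A" for A
      using nM[of ?T "{A}"] conseq_base[OF that, of "{A}"] provable_Sent[OF S' that] by auto
    show "B \<in> ?T \<or> C \<in> ?T" if "Dis B C \<in> ?T" for B C
    proof (rule ccontr)
      assume "\<not> ?thesis"
      \<comment> \<open>Everything outside \<open>M\<close> is an excluded conclusion, so two
        missing disjuncts would exclude their disjunction too.\<close>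
      then have "Dis B C \<in> disjs (- M)" using that by (intro disjs.Dis disjs.base) auto
      then have "conseq (wit_sig S) M (- M)"
        unfolding conseq_def using that provable_hyp[of "Dis B C" "wit_sig S" M] by (intro bexI) simp_all
      then show False using nM[of M "- M"] by (simp add: subset_insertI2)
    qed
    show "\<exists>c\<in>csts (wit_sig S). wit_ant B c \<in> ?T \<longrightarrow> wit_suc B c \<in> ?T" if B: "B \<in> Sent (wit_sig S)" for B
    proof (rule bexI[OF _ Wit_mem[OF B]], rule impI, rule ccontr)
      assume "ant B \<in> ?T" "suc B \<notin> ?T"
      moreover have "suc B \<in> Sent (wit_sig S)" using wit_Sent(2)[OF B Wit_mem[OF B]] .
      ultimately have "conseq_wit S M ({ren Orig A} \<union> - M)"
        by (intro conseq_wit_mono[OF conseq_wit_ant_suc[OF B]]) simp_all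
      with M(2) show False ..
    qed
  qed (use S' in auto)
  moreover have "ren Orig A \<notin> ?T"
  proof
    assume "ren Orig A \<in> ?T"
    then have "conseq (wit_sig S) M {ren Orig A}" by (intro conseq_hyp) simp_all
    then show False using nM[of M "{ren Orig A}"] by simp
  qed
  moreover have "ren Orig ` \<Gamma> \<subseteq> ?T" using M(1) Orig Sent by auto
  ultimately show ?thesis by blast
qed

context witnessed_theory
begin

section \<open>Membership in a witnessed theory obeys the clauses of the valuation\<close>

lemma provable_T: "A \<in> T \<Longrightarrow> provable S T A"
  using T_Sent by (auto intro: provable_hyp)

lemma T_unary: "(\<And>H. deriv S H A \<Longrightarrow> deriv S H B) \<Longrightarrow> A \<in> T \<Longrightarrow> B \<in> T"
  by (rule closed, rule provable_unary[OF _ provable_T])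

lemma Con_iff: "Con A B \<in> T \<longleftrightarrow> A \<in> T \<and> B \<in> T"
  using T_unary[OF deriv.ConE1[of S _ A B]] T_unary[OF deriv.ConE2[of S _ A B]]
    closed[OF provable_ConI[of S T A B]] provable_T[of A] provable_T[of B]
  by blast

lemma Dis_iff: "Dis A B \<in> Sent S \<Longrightarrow> Dis A B \<in> T \<longleftrightarrow> A \<in> T \<or> B \<in> T"
  using prime[of A B] closed[OF provable_DisI(1)[of S T A B]] closed[OF provable_DisI(2)[of S T B A]]
    provable_T[of A] provable_T[of B]
  by auto

text \<open>Primeness is about disjunctions only, so \<not>\<and>E is used to reach
  \<open>Dis (Neg A) (Neg B)\<close> first.\<close>

lemma Neg_Con_iff:
  assumes Sent: "Con A B \<in> Sent S"
  shows "Neg (Con A B) \<in> T \<longleftrightarrow> Neg A \<in> T \<or> Neg B \<in> T"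
proof
  assume N: "Neg (Con A B) \<in> T"
  have "provable S (insert (Neg A) T) (Dis (Neg A) (Neg B))"
    by (rule provable_DisI(1)[OF provable_hyp]) (use Sent in auto)
  moreover have "provable S (insert (Neg B) T) (Dis (Neg A) (Neg B))"
    by (rule provable_DisI(2)[OF provable_hyp]) (use Sent in auto)
  ultimately have "provable S T (Dis (Neg A) (Neg B))"
    by (rule provable_NegConE[OF provable_T[OF N]])
  then show "Neg A \<in> T \<or> Neg B \<in> T" by (intro prime closed)
next
  have "A \<in> Sent S" "B \<in> Sent S" using Sent by simp_all
  moreover assume "Neg A \<in> T \<or> Neg B \<in> T"
  ultimately show "Neg (Con A B) \<in> T"
    by (elim disjE; elim T_unary[rotated]) (blast intro: deriv.NegConI1 deriv.NegConI2)+
qed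

lemma Neg_Dis_iff: "Neg (Dis A B) \<in> T \<longleftrightarrow> Neg A \<in> T \<and> Neg B \<in> T"
  using T_unary[OF deriv.NegDisE1[of S _ A B]] T_unary[OF deriv.NegDisE2[of S _ A B]]
    closed[OF provable_NegDisI[of S T A B]] provable_T[of "Neg A"] provable_T[of "Neg B"]
  by blast

lemma Neg_Neg_iff: "Neg (Neg A) \<in> T \<longleftrightarrow> A \<in> T"
  using T_unary[OF deriv.DNI[of S _ A]] T_unary[OF deriv.DNE[of S _ A]] by blast

lemma All_iff:
  assumes Sent: "All x A \<in> Sent S"
  shows "All x A \<in> T \<longleftrightarrow> (\<forall>c\<in>csts S. subst A x (Cst c) \<in> T)"
proof
  assume "All x A \<in> T"
  then show "\<forall>c\<in>csts S. subst A x (Cst c) \<in> T"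
    by (intro ballI; elim T_unary[rotated]) (rule deriv.AllE)
next
  assume "\<forall>c\<in>csts S. subst A x (Cst c) \<in> T"
  then show "All x A \<in> T" using witness[of "All x A"] Sent by auto
qed

lemma Ex_iff:
  assumes Sent: "Ex x A \<in> Sent S"
  shows "Ex x A \<in> T \<longleftrightarrow> (\<exists>c\<in>csts S. subst A x (Cst c) \<in> T)"
proof
  assume "Ex x A \<in> T"
  then show "\<exists>c\<in>csts S. subst A x (Cst c) \<in> T" using witness[of "Ex x A"] Sent by auto
next
  assume "\<exists>c\<in>csts S. subst A x (Cst c) \<in> T"
  then obtain c where c: "c \<in> csts S" "subst A x (Cst c) \<in> T" ..
  from c(2) show "Ex x A \<in> T" by (rule T_unary[rotated]) (rule deriv.ExI[OF _ c(1) Sent])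
qed

lemma Neg_All_iff:
  assumes Sent: "All x A \<in> Sent S"
  shows "Neg (All x A) \<in> T \<longleftrightarrow> (\<exists>c\<in>csts S. Neg (subst A x (Cst c)) \<in> T)"
proof
  assume "Neg (All x A) \<in> T"
  then show "\<exists>c\<in>csts S. Neg (subst A x (Cst c)) \<in> T" using witness[of "Neg (All x A)"] Sent by auto
next
  assume "\<exists>c\<in>csts S. Neg (subst A x (Cst c)) \<in> T"
  then obtain c where c: "c \<in> csts S" "Neg (subst A x (Cst c)) \<in> T" ..
  from c(2) show "Neg (All x A) \<in> T" by (rule T_unary[rotated]) (rule deriv.NegAllI[OF _ c(1) Sent])
qed

lemma Neg_Ex_iff:
  assumes Sent: "Ex x A \<in> Sent S"
  shows "Neg (Ex x A) \<in> T \<longleftrightarrow> (\<forall>c\<in>csts S. Neg (subst A x (Cst c)) \<in> T)"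
proof
  assume "Neg (Ex x A) \<in> T"
  then show "\<forall>c\<in>csts S. Neg (subst A x (Cst c)) \<in> T"
    by (intro ballI; elim T_unary[rotated]) (rule deriv.NegExE)
next
  assume "\<forall>c\<in>csts S. Neg (subst A x (Cst c)) \<in> T"
  then show "Neg (Ex x A) \<in> T" using witness[of "Neg (Ex x A)"] Sent by auto
qed

section \<open>Identity as a congruence\<close>

lemma IdE_mem:
  assumes "Eql S c d \<in> T" "subst A x (Cst c) \<in> T" "A \<in> Form S" "fv A \<subseteq> {x}"
  shows "subst A x (Cst d) \<in> T"
  by (rule closed[OF provable_IdE[OF provable_T[OF assms(1)] provable_T[OF assms(2)] assms(3,4)]])

lemma Eql_csts: "Eql S c d \<in> T \<Longrightarrow> c \<in> csts S \<and> d \<in> csts S"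
  using T_Sent Eql_Sent[OF sig] by blast

lemma Eql_refl: "c \<in> csts S \<Longrightarrow> Eql S c c \<in> T"
  using closed[of "Eql S c c"] deriv.IdI[of c S] by (auto simp: provable_def)

lemma Eql_sym:
  assumes "Eql S c d \<in> T"
  shows "Eql S d c \<in> T"
proof -
  have "subst (Pred (ident S) [Var 0, Cst c]) 0 (Cst d) \<in> T"
    by (rule IdE_mem[OF assms])
      (use assms Eql_csts Eql_refl[of c] sig in \<open>auto simp: Eql_def Form_def is_signature_def\<close>)
  then show ?thesis by (simp add: Eql_def)
qed

lemma Eql_trans:
  assumes "Eql S c d \<in> T" "Eql S d e \<in> T"
  shows "Eql S c e \<in> T"
proof -
  have "subst (Pred (ident S) [Cst c, Var 0]) 0 (Cst e) \<in> T"
    by (rule IdE_mem[OF assms(2)])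
      (use assms Eql_csts sig in \<open>auto simp: Eql_def Form_def is_signature_def\<close>)
  then show ?thesis by (simp add: Eql_def)
qed

text \<open>Arguments are replaced one at a time; \<open>bs\<close> is the prefix already treated,
  and \<open>N\<close> covers atoms and negated atoms together.\<close>

lemma Pred_cong:
  assumes N: "N = (\<lambda>A. A) \<or> N = Neg"
  shows "list_all2 (\<lambda>c d. Eql S c d \<in> T) cs ds \<Longrightarrow>
    N (Pred p (map Cst (bs @ cs))) \<in> T \<Longrightarrow> N (Pred p (map Cst (bs @ ds))) \<in> T"
proof (induction cs ds arbitrary: bs rule: list_all2_induct)
  case (Cons c cs d ds)
  let ?A = "N (Pred p (map Cst bs @ Var 0 # map Cst cs))"
  have s: "subst ?A 0 (Cst b) = N (Pred p (map Cst (bs @ b # cs)))" for b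
    using N by (auto simp: o_def)
  have "?A \<in> Form S" "fv ?A \<subseteq> {0}"
    using N T_Sent Cons.prems by (auto simp: Sent_def Form_def)
  then have "subst ?A 0 (Cst d) \<in> T"
    using Cons.prems by (intro IdE_mem[OF Cons.hyps(1)]) (simp_all only: s)
  then show ?case using Cons.IH[of "bs @ [d]"] unfolding s by simp
qed simp

end

text \<open>The quotient of the constants by identity in \<open>T\<close>, realised inside the
  prescribed type: \<open>k c\<close> is the element of \<open>'d\<close> that stands for the class
  of \<open>c\<close>.\<close>

locale canonical = witnessed_theory S T
  for S :: "('c, 'p) signature" and T +
  fixes k :: "'c \<Rightarrow> 'd"
  assumes k_eq: "c \<in> csts S \<Longrightarrow> d \<in> csts S \<Longrightarrow> k c = k d \<longleftrightarrow> Eql S c d \<in> T"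
begin

text \<open>The interpretation \<open>i\<close> of the constants is left open, since the countermodel must be a
  structure for the original signature, of which \<open>S\<close> is the extension by witnesses.\<close>

definition canon :: "('i \<Rightarrow> 'd) \<Rightarrow> ('i, 'p, 'd) struct" where
  "canon i = \<lparr>dom = k ` csts S, cint = i,
     pos = (\<lambda>p. {map k cs |cs. Pred p (map Cst cs) \<in> T}),
     neg = (\<lambda>p. {map k cs |cs. Neg (Pred p (map Cst cs)) \<in> T})\<rparr>"

lemma Pred_Sent:
  "Pred p (map Cst cs) \<in> Sent S \<longleftrightarrow> p \<in> preds S \<and> length cs = arity S p \<and> set cs \<subseteq> csts S"
  by (auto simp: Sent_def Form_def)

text \<open>The extensions in \<open>canon\<close> ask for some list of names of a tuple; by
  congruence the choice of names does not matter.\<close>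

lemma Pred_map_k:
  assumes N: "N = (\<lambda>A. A) \<or> N = Neg" and Sent: "Pred p (map Cst cs) \<in> Sent S"
  shows "(\<exists>ds. map k cs = map k ds \<and> N (Pred p (map Cst ds)) \<in> T) \<longleftrightarrow> N (Pred p (map Cst cs)) \<in> T"
proof
  assume "\<exists>ds. map k cs = map k ds \<and> N (Pred p (map Cst ds)) \<in> T"
  then obtain ds where ds: "map k ds = map k cs" "N (Pred p (map Cst ds)) \<in> T" by metis
  then have "Pred p (map Cst ds) \<in> Sent S" using N T_Sent by auto
  then have "set ds \<subseteq> csts S" "set cs \<subseteq> csts S" using Sent by (simp_all add: Pred_Sent)
  moreover have len: "length ds = length cs" using map_eq_imp_length_eq[OF ds(1)] .
  moreover have "k (ds ! n) = k (cs ! n)" if "n < length cs" for n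
    using arg_cong[OF ds(1), of "\<lambda>l. l ! n"] that len by simp
  ultimately have "list_all2 (\<lambda>c d. Eql S c d \<in> T) ds cs"
    unfolding list_all2_conv_all_nth by (metis k_eq nth_mem subsetD)
  then show "N (Pred p (map Cst cs)) \<in> T" using Pred_cong[OF N, of ds cs p "[]"] ds(2) by simp
qed blast

lemma val_canon: "A \<in> Sent S \<Longrightarrow> val_in (canon i) k A \<longleftrightarrow> A \<in> T"
\<comment> \<open>Structural induction would not reach instances, nor negations such as
  \<open>Neg C\<close> below \<open>Neg (Con C D)\<close>.\<close>
proof (induction A rule: measure_induct_rule[of complexity])
  case (less A)
  have atom: "val_in (canon i) k (N (Pred p ts)) \<longleftrightarrow> N (Pred p ts) \<in> T"
    if Sent: "Pred p ts \<in> Sent S" and N: "N = (\<lambda>A. A) \<or> N = Neg" for N p ts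
  proof -
    have "\<exists>cs. ts = map Cst cs"
    proof (rule ex_map_conv[THEN iffD2], rule ballI)
      fix t assume t: "t \<in> set ts"
      have "Var x \<notin> set ts" for x using Sent by (simp add: Sent_def)
      then show "\<exists>c. t = Cst c" using t by (metis tm.exhaust)
    qed
    then obtain cs where ts: "ts = map Cst cs" ..
    have m: "map (\<lambda>t. cint (hat (canon i)) (the_cst t)) (map (map_tm (\<lambda>c. Inr (k c))) ts) = map k cs"
      by (simp add: ts hat_def)
    have "as \<in> pos (canon i) p \<longleftrightarrow> (\<exists>ds. as = map k ds \<and> Pred p (map Cst ds) \<in> T)"
      "as \<in> neg (canon i) p \<longleftrightarrow> (\<exists>ds. as = map k ds \<and> Neg (Pred p (map Cst ds)) \<in> T)" for as
      by (simp_all add: canon_def)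
    then have "val_in (canon i) k (N (Pred p ts)) \<longleftrightarrow>
        (\<exists>ds. map k cs = map k ds \<and> N (Pred p (map Cst ds)) \<in> T)"
      using N m by (elim disjE) (simp_all del: map_map)
    then show ?thesis using Pred_map_k[OF N, of p cs] Sent unfolding ts by simp
  qed
  have q: "subst B x (Cst c) \<in> Sent S" if "All x B \<in> Sent S \<or> Ex x B \<in> Sent S" "c \<in> csts S" for B x c
    using that by (elim disjE) (auto intro: subst_Sent)
  \<comment> \<open>Every element is some \<open>k c\<close>, so instances by names of elements
    match instances by constants.\<close>
  have dom: "dom (canon i) = k ` csts S" by (simp add: canon_def)
  show ?case
  proof (cases A)
    case (Pred p ts)
    then show ?thesis using atom[of p ts "\<lambda>A. A"] less.prems by simp
  next
    case (Con B C)
    then show ?thesis using less by (simp add: Con_iff)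
  next
    case (Dis B C)
    then show ?thesis using less Dis_iff[of B C] by simp
  next
    case (All x B)
    have "val_in (canon i) k (subst B x (Cst c)) \<longleftrightarrow> subst B x (Cst c) \<in> T" if "c \<in> csts S" for c
      using less.prems All that by (intro less.IH) (auto intro: q)
    then show ?thesis using All_iff[of x B] less.prems All by (simp add: dom)
  next
    case (Ex x B)
    have "val_in (canon i) k (subst B x (Cst c)) \<longleftrightarrow> subst B x (Cst c) \<in> T" if "c \<in> csts S" for c
      using less.prems Ex that by (intro less.IH) (auto intro: q)
    then show ?thesis using Ex_iff[of x B] less.prems Ex by (simp add: dom)
  next
    case (Neg B)
    show ?thesis
    proof (cases B)
      case (Pred p ts)
      then show ?thesis using Neg atom[of p ts Neg] less.prems by simp
    next
      case (Neg C)
      then show ?thesis using \<open>A = Neg B\<close> less by (simp add: Neg_Neg_iff)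
    next
      case (Con C D)
      then show ?thesis
        using \<open>A = Neg B\<close> less.IH[of "Neg C"] less.IH[of "Neg D"] less.prems Neg_Con_iff[of C D] by simp
    next
      case (Dis C D)
      then show ?thesis
        using \<open>A = Neg B\<close> less.IH[of "Neg C"] less.IH[of "Neg D"] less.prems by (simp add: Neg_Dis_iff)
    next
      case (All x C)
      have "val_in (canon i) k (Neg (subst C x (Cst c))) \<longleftrightarrow> Neg (subst C x (Cst c)) \<in> T"
        if "c \<in> csts S" for c
        using less.prems \<open>A = Neg B\<close> All that by (intro less.IH) (auto intro: q)
      then show ?thesis using Neg_All_iff[of x C] less.prems \<open>A = Neg B\<close> All by (simp add: dom)
    next
      case (Ex x C)
      have "val_in (canon i) k (Neg (subst C x (Cst c))) \<longleftrightarrow> Neg (subst C x (Cst c)) \<in> T"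
        if "c \<in> csts S" for c
        using less.prems \<open>A = Neg B\<close> Ex that by (intro less.IH) (auto intro: q)
      then show ?thesis using Neg_Ex_iff[of x C] less.prems \<open>A = Neg B\<close> Ex by (simp add: dom)
    qed
  qed
qed

lemma is_struct_canon:
  assumes S0: "preds S0 = preds S" "arity S0 = arity S" "ident S0 = ident S"
    and i: "i ` csts S0 \<subseteq> k ` csts S"
  shows "is_struct S0 (canon i)"
proof -
  have "csts S \<noteq> {}" using sig by (auto simp: is_signature_def)
  then have "dom (canon i) \<noteq> {}" by (simp add: canon_def)
  moreover have "\<forall>c\<in>csts S0. cint (canon i) c \<in> dom (canon i)" using i by (auto simp: canon_def)
  moreover have "length as = arity S p \<and> set as \<subseteq> dom (canon i)"
    if as: "as \<in> pos (canon i) p \<union> neg (canon i) p" for p as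
  proof -
    obtain cs where cs: "as = map k cs" "Pred p (map Cst cs) \<in> T \<or> Neg (Pred p (map Cst cs)) \<in> T"
      using as by (auto simp: canon_def)
    then have "Pred p (map Cst cs) \<in> Sent S" using T_Sent by auto
    then show ?thesis using cs(1) by (auto simp: Pred_Sent canon_def)
  qed
  moreover have "pos (canon i) (ident S) = {[a, a] |a. a \<in> dom (canon i)}"
  proof (intro equalityI subsetI)
    fix as assume "as \<in> pos (canon i) (ident S)"
    then obtain cs where cs: "as = map k cs" "Pred (ident S) (map Cst cs) \<in> T"
      by (auto simp: canon_def)
    then have "Pred (ident S) (map Cst cs) \<in> Sent S" using T_Sent by auto
    then have "length cs = 2" using sig by (simp add: Pred_Sent is_signature_def)
    then obtain c d where cd: "cs = [c, d]" by (auto simp: length_Suc_conv numeral_2_eq_2)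
    then have E: "Eql S c d \<in> T" using cs by (simp add: Eql_def)
    then have "c \<in> csts S" "d \<in> csts S" using Eql_csts by blast+
    then have "k c = k d" "d \<in> csts S" using E k_eq by simp_all
    then show "as \<in> {[a, a] |a. a \<in> dom (canon i)}" using cs cd by (auto simp: canon_def)
  next
    fix as assume "as \<in> {[a, a] |a. a \<in> dom (canon i)}"
    then obtain c where c: "as = [k c, k c]" "c \<in> csts S" by (auto simp: canon_def)
    then show "as \<in> pos (canon i) (ident S)"
      using Eql_refl[OF c(2)] by (auto simp: canon_def Eql_def intro!: exI[of _ "[c, c]"])
  qed
  ultimately show ?thesis unfolding is_struct_def S0 by blast
qed

end

text \<open>\<open>g\<close> is applied to a chosen representative \<open>r c\<close> of the class
  of \<open>c\<close>, which by \<open>Eql_csts\<close> lies where \<open>g\<close> is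
  injective.\<close>

lemma (in witnessed_theory) ex_canonical:
  fixes g :: "'c \<Rightarrow> 'd"
  assumes "inj_on g (csts S)"
  shows "\<exists>k :: 'c \<Rightarrow> 'd. canonical S T k"
proof -
  define r where "r c = (SOME d. Eql S c d \<in> T)" for c
  have r: "Eql S c (r c) \<in> T" if "c \<in> csts S" for c
    unfolding r_def by (rule someI[of _ c]) (rule Eql_refl[OF that])
  have "canonical S T (\<lambda>c. g (r c))"
  proof
    fix c d assume c: "c \<in> csts S" and d: "d \<in> csts S"
    have "g (r c) = g (r d) \<longleftrightarrow> r c = r d"
      using inj_on_eq_iff[OF assms] Eql_csts r c d by blast
    also have "\<dots> \<longleftrightarrow> Eql S c d \<in> T"
    proof
      assume "r c = r d"
      then show "Eql S c d \<in> T" using r[OF c] r[OF d] Eql_sym Eql_trans by metis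
    next
      assume "Eql S c d \<in> T"
      \<comment> \<open>Both constants define the same choice predicate, hence \<open>SOME\<close>
        returns the same representative.\<close>
      then have "Eql S c e \<in> T \<longleftrightarrow> Eql S d e \<in> T" for e using Eql_sym Eql_trans by metis
      then show "r c = r d" by (simp add: r_def)
    qed
    finally show "g (r c) = g (r d) \<longleftrightarrow> Eql S c d \<in> T" .
  qed
  then show ?thesis by (rule exI[where x = "\<lambda>c. g (r c)"])
qed

section \<open>Coding the witnesses by formulas\<close>

text \<open>The domain of the canonical structure must fit into a type in which the formulas of \<open>S\<close>
  can be injected.  As these formulas are closed under the connectives, the constants of
  \<open>wit_sig S\<close> can be coded by them directly, which avoids all cardinal arithmetic.\<close>

primrec enc_tm :: "('c, 'p) fm \<Rightarrow> ('c, 'p) fm tm \<Rightarrow> ('c, 'p) fm" where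
  "enc_tm X (Var n) = Dis X ((Neg ^^ n) X)"
| "enc_tm X (Cst B) = Con X B"

primrec enc_tms :: "('c, 'p) fm \<Rightarrow> ('c, 'p) fm tm list \<Rightarrow> ('c, 'p) fm" where
  "enc_tms X [] = X"
| "enc_tms X (t # ts) = Con (enc_tm X t) (enc_tms X ts)"

text \<open>\<open>Eql S z z\<close> is an atomic filler, distinct from every compound, and its
  iterated negations code numbers. The two outermost layers tell the constructors apart. No
  quantifier is introduced, so the ban on void ones causes no trouble.\<close>

primrec enc_fm :: "('c, 'p) signature \<Rightarrow> 'c \<Rightarrow> (('c, 'p) fm, 'p) fm \<Rightarrow> ('c, 'p) fm" where
  "enc_fm S z (Pred p ts) =
     Con (Pred p (replicate (arity S p) (Cst z))) (enc_tms (Eql S z z) ts)"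
| "enc_fm S z (Neg A) = Neg (enc_fm S z A)"
| "enc_fm S z (Con A B) = Dis (Con (enc_fm S z A) (enc_fm S z B)) (Eql S z z)"
| "enc_fm S z (Dis A B) = Dis (Dis (enc_fm S z A) (enc_fm S z B)) (Eql S z z)"
| "enc_fm S z (All x A) = Dis (Neg (enc_fm S z A)) ((Neg ^^ x) (Eql S z z))"
| "enc_fm S z (Ex x A) = Dis (Eql S z z) (Con ((Neg ^^ x) (Eql S z z)) (enc_fm S z A))"

text \<open>The cases differ in their head symbol. Constants inside a witness are coded first, which
  is why \<open>enc_fm\<close> takes formulas as constants.\<close>

primrec enc :: "('c, 'p) signature \<Rightarrow> 'c \<Rightarrow> ('c, 'p) wcst \<Rightarrow> ('c, 'p) fm" where
  "enc S z (Orig c) = Eql S c c"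
| "enc S z (Wit A) = Neg (enc_fm S z (map_fm (enc S z) (\<lambda>p. p) A))"

lemma funpow_Neg_inj: "(Neg ^^ m) (Pred p ts) = (Neg ^^ n) (Pred p ts) \<Longrightarrow> m = n"
proof (induction m arbitrary: n)
  case 0
  then show ?case by (cases n) auto
next
  case (Suc m)
  then show ?case by (cases n) auto
qed

lemma enc_tm_inj: "enc_tm (Eql S z z) s = enc_tm (Eql S z z) t \<Longrightarrow> s = t"
  by (cases s; cases t) (auto simp: Eql_def dest: funpow_Neg_inj)

lemma enc_tms_inj: "enc_tms (Eql S z z) ss = enc_tms (Eql S z z) ts \<Longrightarrow> ss = ts"
proof (induction ss arbitrary: ts)
  case Nil
  then show ?case by (cases ts) (auto simp: Eql_def)
next
  case (Cons s ss)
  then show ?case by (cases ts) (auto simp: Eql_def[of S z z] dest: enc_tm_inj[of S z, unfolded Eql_def])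
qed

lemma enc_fm_inj: "enc_fm S z A = enc_fm S z B \<Longrightarrow> A = B"
proof (induction A arbitrary: B)
  case (Pred p ts)
  then show ?case by (cases B) (auto dest: enc_tms_inj)
next
  case (Neg A)
  then show ?case by (cases B) auto
next
  case (Con A1 A2)
  then show ?case by (cases B) (auto simp: Eql_def)
next
  case (Dis A1 A2)
  then show ?case by (cases B) (auto simp: Eql_def)
next
  case (All x A)
  then show ?case by (cases B) (auto simp: Eql_def dest: funpow_Neg_inj)
next
  case (Ex x A)
  then show ?case by (cases B) (auto simp: Eql_def dest: funpow_Neg_inj)
qed

lemma enc_inj: "enc S z g = enc S z h \<Longrightarrow> g = h"
proof (induction g arbitrary: h)
  case (Orig c)
  then show ?case by (cases h) (auto simp: Eql_def)
next
  case (Wit A)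
  then obtain B where h: "h = Wit B" and "ren (enc S z) A = ren (enc S z) B"
    by (cases h) (auto simp: Eql_def dest: enc_fm_inj)
  then have "A = B" by (intro fm.inj_map_strong[OF _ _ \<open>ren (enc S z) A = ren (enc S z) B\<close>] Wit.IH)
  then show ?case using h by simp
qed

lemma enc_fm_is_form:
  assumes S: "is_signature S" and z: "z \<in> csts S"
  shows "preds_fm A \<subseteq> preds S \<Longrightarrow> \<forall>B\<in>csts_fm A. is_form S B \<Longrightarrow> is_form S (enc_fm S z A)"
proof (induction A)
  have X: "is_form S (Eql S z z)" "is_form S ((Neg ^^ n) (Eql S z z))" for n
    using Eql_Sent[OF S, of z z] z by (induction n) (simp_all add: Sent_def Form_def)
  {
    case (Pred p ts)
    have "is_form S (enc_tms (Eql S z z) ts)" if "\<forall>t\<in>set ts. \<forall>B\<in>csts_tm t. is_form S B"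
      using that
    proof (induction ts)
      case (Cons t ts)
      then show ?case by (cases t) (use X in auto)
    qed (simp add: X)
    then show ?case using Pred z by auto
  next
    case (All x A)
    then show ?case using X by simp
  next
    case (Ex x A)
    then show ?case using X by simp
  next
    case (Con A B)
    then show ?case using X by simp
  next
    case (Dis A B)
    then show ?case using X by simp
  next
    case (Neg A)
    then show ?case by simp
  }
qed

lemma enc_is_form:
  assumes S: "is_signature S" and z: "z \<in> csts S"
  shows "h \<in> csts (wit_sig S) \<Longrightarrow> is_form S (enc S z h)"
proof (induction h)
  case (Orig c)
  then show ?case using Eql_Sent[OF S, of c c] by (simp add: Sent_def Form_def)
next
  case (Wit A)
  have "preds_fm A \<subseteq> preds S" "csts_fm A \<subseteq> csts (wit_sig S)"
    using Wit.prems by (auto simp: wit_sig_def)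
  then have "is_form S (enc_fm S z (ren (enc S z) A))"
    using Wit.IH by (intro enc_fm_is_form[OF S z]) (auto simp: fm.set_map)
  then show ?case by simp
qed

section \<open>Completeness\<close>

lemma completeness:
  fixes S :: "('c, 'p) signature"
  assumes S: "is_signature S" and Sent: "\<Gamma> \<union> {A} \<subseteq> Sent S"
    and large: "large_type TYPE('d) S" and ent: "entails TYPE('d) S \<Gamma> A"
  shows "provable S \<Gamma> A"
proof (rule ccontr)
  assume "\<not> provable S \<Gamma> A"
  then obtain T where T: "witnessed_theory (wit_sig S) T" "ren Orig ` \<Gamma> \<subseteq> T" "ren Orig A \<notin> T"
    using ex_witnessed_theory[OF S Sent] by blast
  obtain z where z: "z \<in> csts S"
    using S by (metis is_signature_def finite.emptyI ex_in_conv)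
  obtain f :: "('c, 'p) fm \<Rightarrow> 'd" where f: "inj_on f (Form S)"
    using large by (auto simp: large_type_def)
  \<comment> \<open>Coded as formulas of \<open>S\<close>, the extended constants can be carried
    into \<open>'d\<close> by \<open>f\<close>.\<close>
  have "inj_on (\<lambda>h. f (enc S z h)) (csts (wit_sig S))"
  proof (rule inj_onI)
    fix g h assume gh: "g \<in> csts (wit_sig S)" "h \<in> csts (wit_sig S)"
      and "f (enc S z g) = f (enc S z h)"
    then have "enc S z g = enc S z h"
      by (intro inj_onD[OF f]) (simp_all add: Form_def enc_is_form[OF S z])
    then show "g = h" by (rule enc_inj)
  qed
  then obtain k :: "('c, 'p) wcst \<Rightarrow> 'd" where k: "canonical (wit_sig S) T k"
    using witnessed_theory.ex_canonical[OF T(1)] by blast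
  interpret canonical "wit_sig S" T k by (rule k)
  \<comment> \<open>Since \<open>c\<close> takes the value of \<open>Orig c\<close>, this structure
    for \<open>S\<close> evaluates \<open>B\<close> just as \<open>ren Orig B\<close> is evaluated
    over the extension.\<close>
  let ?M = "canon (\<lambda>c. k (Orig c)) :: ('c, 'p, 'd) struct"
  have M: "is_struct S ?M" by (rule is_struct_canon) auto
  have "val ?M (embed B) \<longleftrightarrow> ren Orig B \<in> T" if "B \<in> Sent S" for B
  proof -
    have "ren Orig B \<in> Sent (wit_sig S)"
      by (rule ren_Sent[OF _ _ that csts_Sent[OF that]]) auto
    then have "val_in ?M k (ren Orig B) \<longleftrightarrow> ren Orig B \<in> T" by (rule val_canon)
    moreover have "cint ?M = (\<lambda>c. k (Orig c))" by (simp add: canon_def)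
    ultimately show ?thesis by (simp add: val_embed fm.map_comp o_def)
  qed
  then show False using ent M T(2,3) Sent unfolding entails_def by blast
qed

theorem mainTheorem3:
  fixes S :: "('c, 'p) signature"
    and \<Gamma> :: "('c, 'p) fm set"
    and A :: "('c, 'p) fm"
  assumes "is_signature S"
    and "\<Gamma> \<union> {A} \<subseteq> Sent S"
  shows "(provable S \<Gamma> A \<longrightarrow> entails TYPE('d) S \<Gamma> A) \<and>
         (large_type TYPE('d) S \<longrightarrow> (provable S \<Gamma> A \<longleftrightarrow> entails TYPE('d) S \<Gamma> A))"
proof -
  have "provable S \<Gamma> A \<longrightarrow> entails TYPE('d) S \<Gamma> A"
    using soundness[OF assms(1)] unfolding entails_def by blast
  then show ?thesis using completeness[OF assms] by blast
qed

end
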